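(* Let $(G,s,t)$ be an $st$-connected net. Then $G$ is vulnerable if and only if there exists an $st$-embedding of the Wheatstone graph $\mathcal W$ into $(G,s,t)$.
   Context: Graphs are finite. A multi-digraph $G=(V,E)$ has a set $V$ of nodes and a set $E$ of edges, each edge relating an ordered pair of nodes; parallel edges are allowed. A net $(G,s,t)$ is a multi-digraph with a chosen source $s$ and target $t$. A path is a sequence $u_1e_1u_2\dots e_{n-1}u_n$ ($n\ge 1$) with $e_i$ relating $(u_i,u_{i+1})$; it is simple if no node repeats. An $st$-path is a path from $s$ to $t$; $SP(G)$ is the set of simple $st$-paths. The net is $st$-connected if every node lies on an $st$-path (not necessarily simple). Flows and vulnerability. Let $\mathbb R^+$ be the non-negative reals. A flow is a function $\varphi:SP(G)\to\mathbb R^+$; its value is $\sum_p\varphi(p)$, and $\varphi(e)=\sum_{p\in SP(G):\,e\in p}\varphi(p)$ for an edge $e$ (an $st$-path that is not simple carries no flow). A latency function $l$ assigns to each edge $e$ a continuous non-decreasing function $l_e:\mathbb R^+\to\mathbb R^+$; the latency of an $st$-path $p$ is $l_p(\varphi)=\sum_{e\in p}l_e(\varphi(e))$. An instance is $(G,r,l)$ with $r\in\mathbb R^+$. A flow of value $r$ is a Wardrop flow for $(G,r,l)$ if for all $st$-paths $p,q$ with $\varphi(p)>0$ one has $l_p(\varphi)\le l_q(\varphi)$. For $r>0$ (and $G$ having at least one $st$-path) a Wardrop flow exists, and $L(G,r,l)$ denotes the common latency of all $st$-paths with positive flow in a Wardrop flow (it does not depend on the Wardrop flow chosen); $L(G,0,l)=0$.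 The net $G$ is vulnerable if there exist $r$, $l$ and a subgraph $H$ of $G$ (with the same $s,t$, and containing at least one $st$-path) such that $L(G,r,l)>L(H,r,l|_H)$, where $l|_H$ is the restriction of $l$ to the edges of $H$. Embedding. $\mathcal W$ is the digraph with nodes $a,b,c,d$ and edges $a\to b$, $a\to c$, $b\to c$, $b\to d$, $c\to d$. An $st$-embedding of $\mathcal W$ into $(G,s,t)$ consists of an injective map $\phi$ from the nodes of $\mathcal W$ to the nodes of $G$ and an injective map $\psi$ assigning to each edge $x\to y$ of $\mathcal W$ a simple path of $G$ from $\phi(x)$ to $\phi(y)$, such that the five paths in the image of $\psi$ are pairwise node-disjoint except for the endpoints they share as images of common endpoints in $\mathcal W$; and such that there are (possibly empty) simple paths from $s$ to $\phi(a)$ and from $\phi(d)$ to $t$ that are node-disjoint from each other and that meet the paths in the image of $\psi$ only in $\phi(a)$ and only in $\phi(d)$, respectively. *)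

theory Defs
  imports Complex_Main "Graph_Theory.Arc_Walk" "Graph_Theory.Digraph_Component"
begin

section \<open>Nets\<close>

locale st_net = fin_digraph G for G :: "('a, 'b) pre_digraph" +
  fixes s t :: 'a
  assumes source_in_verts: "s \<in> verts G"
    and target_in_verts: "t \<in> verts G"

text \<open>
  Paths are represented by their list of arcs (type \<open>'b awalk\<close>). Together with the start node,
  which is always known from the context, this list determines the alternating sequence of nodes
  and arcs. A path is an \<open>awalk\<close>, a simple path an \<open>apath\<close>; the empty list is the path with a
  single node.
\<close>

definition st_paths :: "('a, 'b) pre_digraph \<Rightarrow> 'a \<Rightarrow> 'a \<Rightarrow> 'b awalk set" where
  "st_paths G s t = {p. pre_digraph.awalk G s p t}"

definition SP :: "('a, 'b) pre_digraph \<Rightarrow> 'a \<Rightarrow> 'a \<Rightarrow> 'b awalk set" where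
  "SP G s t = {p. pre_digraph.apath G s p t}"

definition st_connected :: "('a, 'b) pre_digraph \<Rightarrow> 'a \<Rightarrow> 'a \<Rightarrow> bool" where
  "st_connected G s t \<longleftrightarrow>
     (\<forall>v\<in>verts G. \<exists>p\<in>st_paths G s t. v \<in> set (pre_digraph.awalk_verts G s p))"


section \<open>Flows, latencies and vulnerability\<close>

text \<open>
  Flows are total functions that vanish outside the set of simple \<open>st\<close>-paths; so they correspond
  to non-negative functions on that set, and \<open>st\<close>-paths that are not simple carry no flow.
\<close>

definition is_flow ::
    "('a, 'b) pre_digraph \<Rightarrow> 'a \<Rightarrow> 'a \<Rightarrow> ('b awalk \<Rightarrow> real) \<Rightarrow> bool" where
  "is_flow G s t \<phi> \<longleftrightarrow>
     (\<forall>p\<in>SP G s t. 0 \<le> \<phi> p) \<and> (\<forall>p. p \<notin> SP G s t \<longrightarrow> \<phi> p = 0)"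

definition flow_value ::
    "('a, 'b) pre_digraph \<Rightarrow> 'a \<Rightarrow> 'a \<Rightarrow> ('b awalk \<Rightarrow> real) \<Rightarrow> real" where
  "flow_value G s t \<phi> = (\<Sum>p\<in>SP G s t. \<phi> p)"

definition arc_flow ::
    "('a, 'b) pre_digraph \<Rightarrow> 'a \<Rightarrow> 'a \<Rightarrow> ('b awalk \<Rightarrow> real) \<Rightarrow> 'b \<Rightarrow> real" where
  "arc_flow G s t \<phi> e = (\<Sum>p\<in>{p \<in> SP G s t. e \<in> set p}. \<phi> p)"

definition latency_fun :: "('a, 'b) pre_digraph \<Rightarrow> ('b \<Rightarrow> real \<Rightarrow> real) \<Rightarrow> bool" where
  "latency_fun G l \<longleftrightarrow>
     (\<forall>e\<in>arcs G. continuous_on {0..} (l e) \<and> mono_on {0..} (l e) \<and> (\<forall>x\<ge>0. 0 \<le> l e x))"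

text \<open>
  The sum runs over the sequence of arcs of the path, so an arc that a non-simple path traverses
  several times is counted with multiplicity.
\<close>

definition path_latency ::
    "('a, 'b) pre_digraph \<Rightarrow> 'a \<Rightarrow> 'a \<Rightarrow> ('b \<Rightarrow> real \<Rightarrow> real) \<Rightarrow> ('b awalk \<Rightarrow> real) \<Rightarrow> 'b awalk \<Rightarrow> real"
  where
  "path_latency G s t l \<phi> p = (\<Sum>e\<leftarrow>p. l e (arc_flow G s t \<phi> e))"

definition wardrop_flow ::
    "('a, 'b) pre_digraph \<Rightarrow> 'a \<Rightarrow> 'a \<Rightarrow> real \<Rightarrow> ('b \<Rightarrow> real \<Rightarrow> real) \<Rightarrow> ('b awalk \<Rightarrow> real) \<Rightarrow> bool"
  where
  "wardrop_flow G s t r l \<phi> \<longleftrightarrow>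
     is_flow G s t \<phi> \<and> flow_value G s t \<phi> = r \<and>
     (\<forall>p\<in>st_paths G s t. \<forall>q\<in>st_paths G s t.
        \<phi> p > 0 \<longrightarrow> path_latency G s t l \<phi> p \<le> path_latency G s t l \<phi> q)"

definition wardrop_latency ::
    "('a, 'b) pre_digraph \<Rightarrow> 'a \<Rightarrow> 'a \<Rightarrow> real \<Rightarrow> ('b \<Rightarrow> real \<Rightarrow> real) \<Rightarrow> real" where
  "wardrop_latency G s t r l =
     (if r = 0 then 0
      else (THE x. \<exists>\<phi>. wardrop_flow G s t r l \<phi> \<and>
              (\<exists>p\<in>st_paths G s t. \<phi> p > 0 \<and> x = path_latency G s t l \<phi> p)))"

text \<open>
  A latency function for \<open>G\<close> is restricted to a subgraph \<open>H\<close> implicitly: its values outside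
  \<open>arcs H\<close> do not affect \<open>wardrop_latency H\<close>.
\<close>

definition vulnerable :: "('a, 'b) pre_digraph \<Rightarrow> 'a \<Rightarrow> 'a \<Rightarrow> bool" where
  "vulnerable G s t \<longleftrightarrow>
     (\<exists>r l H. r \<ge> 0 \<and> latency_fun G l \<and> subgraph H G \<and> st_paths H s t \<noteq> {} \<and>
        wardrop_latency G s t r l > wardrop_latency H s t r l)"


section \<open>Embeddings of the Wheatstone graph\<close>

datatype wnode = Wa | Wb | Wc | Wd

definition wheatstone :: "(wnode, wnode \<times> wnode) pre_digraph" where
  "wheatstone =
     \<lparr> verts = {Wa, Wb, Wc, Wd},
       arcs = {(Wa, Wb), (Wa, Wc), (Wb, Wc), (Wb, Wd), (Wc, Wd)},
       tail = fst, head = snd \<rparr>"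

text \<open>
  \<open>nodes e\<close> below is the set of nodes of the path in \<open>G\<close> assigned to the arc \<open>e\<close>.
\<close>

definition st_embedding ::
    "('a, 'b) pre_digraph \<Rightarrow> 'a \<Rightarrow> 'a \<Rightarrow> (wnode \<Rightarrow> 'a) \<Rightarrow> (wnode \<times> wnode \<Rightarrow> 'b awalk) \<Rightarrow> bool"
  where
  "st_embedding G s t \<phi> \<psi> \<longleftrightarrow>
     (let W = wheatstone;
          nodes = (\<lambda>e. set (pre_digraph.awalk_verts G (\<phi> (tail W e)) (\<psi> e)))
      in
        \<phi> ` verts W \<subseteq> verts G \<and> inj_on \<phi> (verts W) \<and> inj_on \<psi> (arcs W) \<and>
        (\<forall>e\<in>arcs W. pre_digraph.apath G (\<phi> (tail W e)) (\<psi> e) (\<phi> (head W e))) \<and>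
        (\<forall>e\<in>arcs W. \<forall>f\<in>arcs W. e \<noteq> f \<longrightarrow>
           nodes e \<inter> nodes f \<subseteq> \<phi> ` ({tail W e, head W e} \<inter> {tail W f, head W f})) \<and>
        (\<exists>p q.
           pre_digraph.apath G s p (\<phi> Wa) \<and>
           pre_digraph.apath G (\<phi> Wd) q t \<and>
           set (pre_digraph.awalk_verts G s p) \<inter> set (pre_digraph.awalk_verts G (\<phi> Wd) q) = {} \<and>
           set (pre_digraph.awalk_verts G s p) \<inter> (\<Union>e\<in>arcs W. nodes e) = {\<phi> Wa} \<and>
           set (pre_digraph.awalk_verts G (\<phi> Wd) q) \<inter> (\<Union>e\<in>arcs W. nodes e) = {\<phi> Wd}))"

end

theory Submission
  imports Defs "HOL-Analysis.Analysis"
begin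

text \<open>
  Suppose that a flow \<open>\<psi>\<close> in a subnet \<open>H\<close> has smaller latency than a flow \<open>\<phi>\<close> of the same value in
  \<open>G\<close>, both Wardrop. No \<open>st\<close>-path consists of arcs with \<open>0 < \<psi> e\<close> and \<open>\<phi> e \<le> \<psi> e\<close> only: such
  a path is shortest for \<open>\<psi>\<close>, and monotonicity of the latencies would give the opposite inequality.
  So the remaining arcs contain a minimal cut. If every simple \<open>st\<close>-path crossed that cut exactly
  once, both flows would cross it with their full value, although \<open>\<psi> e \<le> \<phi> e\<close> on the cut, with
  equality only if \<open>\<psi> e = 0\<close>. Hence some simple path crosses a minimal cut at least twice, and from
  one with the fewest such crossings an embedding of the Wheatstone graph is read off directly.
  Conversely, Braess's example can be placed on an embedded Wheatstone graph, all other arcs being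
  too expensive to use; node potentials bound the latency of every path from below.
\<close>

section \<open>Walks\<close>

context wf_digraph
begin

section \<open>Splitting and joining simple paths\<close>

lemma apath_imp_distinct: "apath u p v \<Longrightarrow> distinct p"
  by (auto simp: apath_def intro: distinct_verts_imp_distinct)

lemma last_in_awalk_verts: "awalk u p v \<Longrightarrow> v \<in> set (awalk_verts u p)"
  by (metis awalkE' awalk_verts_non_Nil last_in_set)

text \<open>A simple path visits no node twice, so the two parts can share only the node
  \<open>w\<close> at which they are joined.\<close>

lemma apath_append_verts_Int:
  assumes "apath u (p @ q) v" "awalk u p w"
  shows "apath u p w" "apath w q v" "set (awalk_verts u p) \<inter> set (awalk_verts w q) = {w}"
proof -
  have l: "awlast u p = w" using assms by auto
  have *: "apath u p w" "apath w q v" "set (awalk_verts u p) \<inter> set (tl (awalk_verts w q)) = {}"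
    using assms(1) unfolding apath_append_iff l by auto
  then show "apath u p w" "apath w q v" by auto
  have "awalk_verts w q = w # tl (awalk_verts w q)"
    using *(2) unfolding apath_def by (cases q) (auto simp: awalk_Cons_iff awalk_Nil_iff)
  then have "set (awalk_verts w q) = insert w (set (tl (awalk_verts w q)))"
    by (metis list.simps(15))
  moreover have "w \<in> set (awalk_verts u p)" using assms(2) by (rule last_in_awalk_verts)
  ultimately show "set (awalk_verts u p) \<inter> set (awalk_verts w q) = {w}" using *(3) by auto
qed

lemma apath_appendI:
  assumes "apath u p w" "apath w q v" "set (awalk_verts u p) \<inter> set (awalk_verts w q) \<subseteq> {w}"
  shows "apath u (p @ q) v"
proof -
  have l: "awlast u p = w" using assms by (auto simp: apath_def)
  have "awalk_verts w q = w # tl (awalk_verts w q)"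
    using assms(2) unfolding apath_def by (cases q) (auto simp: awalk_Cons_iff awalk_Nil_iff)
  then have "w \<notin> set (tl (awalk_verts w q))" "set (tl (awalk_verts w q)) \<subseteq> set (awalk_verts w q)"
    using assms(2) unfolding apath_def by (metis distinct.simps(2), metis set_subset_Cons)
  then show ?thesis using assms unfolding apath_append_iff l by auto
qed

lemma apath_split:
  assumes "apath u p v" "w \<in> set (awalk_verts u p)"
  obtains q r where "p = q @ r" "apath u q w" "apath w r v"
    "set (awalk_verts u q) \<inter> set (awalk_verts w r) = {w}"
    "set (awalk_verts u p) = set (awalk_verts u q) \<union> set (awalk_verts w r)"
proof -
  obtain q r where *: "p = q @ r" "awalk u q w" "awalk w r v"
    using awalk_decomp[OF _ assms(2), of v] assms(1) by (auto simp: apath_def)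
  note ** = apath_append_verts_Int[OF assms(1)[unfolded *(1)] *(2)]
  show ?thesis
    by (rule that[OF *(1) **]) (unfold *(1), rule set_awalk_verts_append[OF *(2,3)])
qed

text \<open>Takes one arc \<open>e\<close> out of a simple path: what precedes \<open>e\<close> and
  what follows it have no node in common. This separates the parts of the spine before, between and
  after two arcs of the cut.\<close>

lemma apath_Cons_verts:
  assumes "apath u p x" "apath x (e # q) v" "set (awalk_verts u p) \<inter> set (awalk_verts x (e # q)) = {x}"
  shows "set (awalk_verts u p) \<inter> set (awalk_verts (head G e) q) = {}" 
    and "e \<in> arcs G" "tail G e = x" "apath (head G e) q v" "apath u (p @ [e]) (head G e)"
proof -
  show *: "e \<in> arcs G" "tail G e = x" "apath (head G e) q v" using assms(2) by (auto simp: apath_Cons_iff)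
  have **: "x \<notin> set (awalk_verts (head G e) q)" "set (awalk_verts (head G e) q) \<subseteq> set (awalk_verts x (e # q))"
    using assms(2) by (auto simp: apath_Cons_iff)
  then show "set (awalk_verts u p) \<inter> set (awalk_verts (head G e) q) = {}" using assms(3) by auto
  moreover have "head G e \<in> set (awalk_verts (head G e) q)"
    using *(3) by (auto simp: hd_in_awalk_verts)
  ultimately have "head G e \<noteq> x" "head G e \<notin> set (awalk_verts u p)" using **(1) by auto
  then show "apath u (p @ [e]) (head G e)"
    using assms(1) * by (intro apath_appendI[of u p x]) (auto simp: apath_simps)
qed

text \<open>Both ends of a common arc would be the node \<open>w\<close>, but a simple path contains
  no loop.\<close>

lemma arcs_disjoint_if_verts_meet_once:
  assumes "apath u p v" "awalk u' q v'" "set (awalk_verts u p) \<inter> set (awalk_verts u' q) \<subseteq> {w}"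
  shows "set p \<inter> set q = {}"
proof (rule ccontr)
  assume "\<not> ?thesis"
  then obtain e where e: "e \<in> set p" "e \<in> set q" by auto
  have "awalk u p v" using assms(1) by (simp add: apath_def)
  then have "tail G e \<in> set (awalk_verts u p) \<inter> set (awalk_verts u' q)"
    "head G e \<in> set (awalk_verts u p) \<inter> set (awalk_verts u' q)"
    using awalk_verts_arc1 awalk_verts_arc2 assms(2) e by auto
  then have "tail G e = w" "head G e = w" using assms(3) by auto
  with no_loops_in_apath[OF assms(1) e(1)] show False by simp
qed

text \<open>Among all walks with arcs in \<open>D\<close> from any node of \<open>X\<close> to any
  node of \<open>Y\<close>, take one with the fewest arcs. A repeated node, a later node in
  \<open>X\<close> or an earlier node in \<open>Y\<close> would give a shorter one.\<close>

lemma shortest_link: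
  assumes "awalk u p v" "set p \<subseteq> D" "u \<in> X" "v \<in> Y"
  obtains a r c where "a \<in> X" "c \<in> Y" "apath a r c" "set r \<subseteq> D"
    "set (awalk_verts a r) \<inter> X = {a}" "set (awalk_verts a r) \<inter> Y = {c}"
proof -
  define P where "P r \<longleftrightarrow> (\<exists>a\<in>X. \<exists>c\<in>Y. awalk a r c \<and> set r \<subseteq> D)" for r
  have "P p" using assms by (auto simp: P_def)
  then obtain r where r: "P r" and min: "\<And>r'. P r' \<Longrightarrow> length r \<le> length r'"
    using ex_has_least_nat[of P p length] by blast
  from r obtain a c where ac: "a \<in> X" "c \<in> Y" "awalk a r c" "set r \<subseteq> D" by (auto simp: P_def)
  have "distinct (awalk_verts a r)"
  proof (rule ccontr)
    assume "\<not> ?thesis"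
    then obtain x y z w where *: "r = x @ y @ z" "0 < length y" "awalk a x w" "awalk w z c"
      using awalk_not_distinct_decomp[OF ac(3)] by blast
    then have "awalk a (x @ z) c" "set (x @ z) \<subseteq> D" using ac(4) awalk_appendI[of a x w z c] by auto
    then have "P (x @ z)" using ac(1,2) unfolding P_def by blast
    with min[of "x @ z"] * show False by auto
  qed
  moreover have "w = a" if w: "w \<in> set (awalk_verts a r)" "w \<in> X" for w
  proof -
    obtain x y where *: "r = x @ y" "awalk a x w" "awalk w y c" using awalk_decomp[OF ac(3) w(1)] by blast
    then have "P y" using ac w unfolding P_def by (intro bexI[of _ w] bexI[of _ c]) auto
    with min[of y] * show "w = a" by (auto simp: awalk_Nil_iff)
  qed
  moreover have "w = c" if w: "w \<in> set (awalk_verts a r)" "w \<in> Y" for w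
  proof -
    obtain x y where *: "r = x @ y" "awalk a x w" "awalk w y c" using awalk_decomp[OF ac(3) w(1)] by blast
    then have "P x" using ac w unfolding P_def by (intro bexI[of _ a] bexI[of _ w]) auto
    with min[of x] * show "w = c" by (auto simp: awalk_Nil_iff)
  qed
  ultimately show thesis
    using ac by (intro that[of a c r]) (auto simp: apath_def hd_in_awalk_verts last_in_awalk_verts)
qed

end


section \<open>Paths with two crossing ears\<close>

context wf_digraph
begin

text \<open>The spine from \<open>s\<close> to \<open>t\<close> visits \<open>a\<close>, \<open>b\<close>, \<open>c\<close>, \<open>d\<close> in this order; the ears are \<open>ac\<close> and \<open>bd\<close>.\<close>

definition crossed_path where
  "crossed_path s t a b c d p ab ac bc bd cd q \<longleftrightarrow>
     apath s (p @ ab @ bc @ cd @ q) t \<and> ab \<noteq> [] \<and> bc \<noteq> [] \<and> cd \<noteq> [] \<and>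
     awalk s p a \<and> awalk a ab b \<and> awalk b bc c \<and> awalk c cd d \<and> awalk d q t \<and>
     apath a ac c \<and> apath b bd d \<and>
     set (awalk_verts a ac) \<inter> set (awalk_verts s (p @ ab @ bc @ cd @ q)) = {a, c} \<and>
     set (awalk_verts b bd) \<inter> set (awalk_verts s (p @ ab @ bc @ cd @ q)) = {b, d} \<and>
     set (awalk_verts a ac) \<inter> set (awalk_verts b bd) = {}"

text \<open>Cutting the spine successively at \<open>a\<close>, \<open>b\<close>, \<open>c\<close>,
  \<open>d\<close> gives the intersections of its pieces; each ear meets the spine only in its two
  ends. The result has the pairwise form that an embedding requires.\<close>

lemma crossed_path_facts:
  assumes "crossed_path s t a b c d p ab ac bc bd cd q"
  shows "apath s p a" "apath a ab b" "apath a ac c" "apath b bc c" "apath b bd d" "apath c cd d" "apath d q t"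
    and "distinct [a, b, c, d]"
    and "set (awalk_verts a ab) \<inter> set (awalk_verts a ac) = {a}"
    and "set (awalk_verts a ab) \<inter> set (awalk_verts b bc) = {b}"
    and "set (awalk_verts a ab) \<inter> set (awalk_verts b bd) = {b}"
    and "set (awalk_verts a ab) \<inter> set (awalk_verts c cd) = {}"
    and "set (awalk_verts a ac) \<inter> set (awalk_verts b bc) = {c}"
    and "set (awalk_verts a ac) \<inter> set (awalk_verts b bd) = {}"
    and "set (awalk_verts a ac) \<inter> set (awalk_verts c cd) = {c}"
    and "set (awalk_verts b bc) \<inter> set (awalk_verts b bd) = {b}"
    and "set (awalk_verts b bc) \<inter> set (awalk_verts c cd) = {c}"
    and "set (awalk_verts b bd) \<inter> set (awalk_verts c cd) = {d}"
    and "set (awalk_verts s p) \<inter> set (awalk_verts d q) = {}"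
    and "set (awalk_verts s p) \<inter> set (awalk_verts a ab) = {a}"
    and "set (awalk_verts s p) \<inter> set (awalk_verts a ac) = {a}"
    and "set (awalk_verts s p) \<inter> set (awalk_verts b bc) = {}"
    and "set (awalk_verts s p) \<inter> set (awalk_verts b bd) = {}"
    and "set (awalk_verts s p) \<inter> set (awalk_verts c cd) = {}"
    and "set (awalk_verts d q) \<inter> set (awalk_verts a ab) = {}"
    and "set (awalk_verts d q) \<inter> set (awalk_verts a ac) = {}"
    and "set (awalk_verts d q) \<inter> set (awalk_verts b bc) = {}"
    and "set (awalk_verts d q) \<inter> set (awalk_verts b bd) = {d}"
    and "set (awalk_verts d q) \<inter> set (awalk_verts c cd) = {d}"
proof -
  note A = assms[unfolded crossed_path_def]
  have w: "awalk s p a" "awalk a ab b" "awalk b bc c" "awalk c cd d" "awalk d q t" 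
    and P: "apath s (p @ ab @ bc @ cd @ q) t" using A by auto
  note 1 = apath_append_verts_Int[OF P w(1)]
  note 2 = apath_append_verts_Int[OF 1(2) w(2)]
  note 3 = apath_append_verts_Int[OF 2(2) w(3)]
  note 4 = apath_append_verts_Int[OF 3(2) w(4)]
  show *: "apath s p a" "apath a ab b" "apath a ac c" "apath b bc c" "apath b bd d" "apath c cd d" "apath d q t"
    using 1 2 3 4 A by auto
  have w': "awalk c (cd @ q) t" "awalk b (bc @ cd @ q) t" "awalk a (ab @ bc @ cd @ q) t"
    using w by (auto intro!: awalk_appendI)
  note s4 = set_awalk_verts_append[OF w(4,5)]
  note s3 = set_awalk_verts_append[OF w(3) w'(1), unfolded s4]
  note s2 = set_awalk_verts_append[OF w(2) w'(2), unfolded s3]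
  note s1 = set_awalk_verts_append[OF w(1) w'(3), unfolded s2]
  let ?p = "set (awalk_verts s p)" and ?q = "set (awalk_verts d q)"
  let ?ab = "set (awalk_verts a ab)" and ?bc = "set (awalk_verts b bc)" and ?cd = "set (awalk_verts c cd)"
  let ?ac = "set (awalk_verts a ac)" and ?bd = "set (awalk_verts b bd)"
  have ne: "a \<noteq> b" "b \<noteq> c" "c \<noteq> d"
    using * A apath_nonempty_ends by auto
  have I: "?p \<inter> (?ab \<union> (?bc \<union> (?cd \<union> ?q))) = {a}" "?ab \<inter> (?bc \<union> (?cd \<union> ?q)) = {b}"
    "?bc \<inter> (?cd \<union> ?q) = {c}" "?cd \<inter> ?q = {d}"
    using 1(3) 2(3) 3(3) 4(3) unfolding s2 s3 s4 by auto
  have E: "?ac \<inter> (?p \<union> (?ab \<union> (?bc \<union> (?cd \<union> ?q)))) = {a, c}"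
    "?bd \<inter> (?p \<union> (?ab \<union> (?bc \<union> (?cd \<union> ?q)))) = {b, d}" "?ac \<inter> ?bd = {}"
    using A unfolding s1 by auto
  have m: "a \<in> ?p" "a \<in> ?ab" "b \<in> ?ab" "b \<in> ?bc" "c \<in> ?bc" "c \<in> ?cd" "d \<in> ?cd" "d \<in> ?q"
    "a \<in> ?ac" "c \<in> ?ac" "b \<in> ?bd" "d \<in> ?bd"
    using * by (auto simp: hd_in_awalk_verts last_in_awalk_verts apath_def)
  have J: "x \<in> ?p \<Longrightarrow> x \<in> ?ab \<or> x \<in> ?bc \<or> x \<in> ?cd \<or> x \<in> ?q \<Longrightarrow> x = a"
    "x \<in> ?ab \<Longrightarrow> x \<in> ?bc \<or> x \<in> ?cd \<or> x \<in> ?q \<Longrightarrow> x = b"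
    "x \<in> ?bc \<Longrightarrow> x \<in> ?cd \<or> x \<in> ?q \<Longrightarrow> x = c" for x
    using I by blast+
  \<comment> \<open>Which of the four nodes lie outside which pieces: this reduces bounds such as
    \<open>{a, c}\<close> to the single shared node or to the empty set.\<close>
  have nm1: "a \<notin> ?bc" "a \<notin> ?cd" "a \<notin> ?q" using J(2) m(2) ne(1) by metis+
  have nm2: "b \<notin> ?p" "b \<notin> ?cd" "b \<notin> ?q" using J(1,3) m(3,4) ne(1,2) by metis+
  have nm3: "c \<notin> ?p" "c \<notin> ?ab" using J(1,2) m(5) nm1(1) ne(2) by metis+
  have "c \<notin> ?q" using I(4) m(6) ne(3) by blast
  note nm3 = nm3 this
  have nm4: "d \<notin> ?p" "d \<notin> ?ab" "d \<notin> ?bc" using J m(7) nm1(2) nm2(2) ne(3) by metis+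
  note nm = nm1 nm2 nm3 nm4
  have "a \<noteq> c" "a \<noteq> d" "b \<noteq> d" using nm m by blast+
  with ne show "distinct [a, b, c, d]" by auto
  have E': "?ac \<inter> ?p \<subseteq> {a, c}" "?ac \<inter> ?ab \<subseteq> {a, c}" "?ac \<inter> ?bc \<subseteq> {a, c}" "?ac \<inter> ?cd \<subseteq> {a, c}" "?ac \<inter> ?q \<subseteq> {a, c}"
    "?bd \<inter> ?p \<subseteq> {b, d}" "?bd \<inter> ?ab \<subseteq> {b, d}" "?bd \<inter> ?bc \<subseteq> {b, d}" "?bd \<inter> ?cd \<subseteq> {b, d}" "?bd \<inter> ?q \<subseteq> {b, d}"
    using E(1,2) by auto
  show "?ab \<inter> ?ac = {a}" using E'(2) nm(8) m by blast
  show "?ab \<inter> ?bd = {b}" using E'(7) nm(11) m by blast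
  show "?ac \<inter> ?bc = {c}" using E'(3) nm(1) m by blast
  show "?ac \<inter> ?bd = {}" by (fact E(3))
  show "?ac \<inter> ?cd = {c}" using E'(4) nm(2) m by blast
  show "?bc \<inter> ?bd = {b}" using E'(8) nm(12) m by blast
  show "?bd \<inter> ?cd = {d}" using E'(9) nm(5) m by blast
  show "?p \<inter> ?ac = {a}" using E'(1) nm(7) m by blast
  show "?p \<inter> ?bd = {}" using E'(6) nm(4,10) by blast
  show "?q \<inter> ?ac = {}" using E'(5) nm(3,9) by blast
  show "?q \<inter> ?bd = {d}" using E'(10) nm(6) m by blast
  have I': "?p \<inter> ?ab \<subseteq> {a}" "?p \<inter> ?bc \<subseteq> {a}" "?p \<inter> ?cd \<subseteq> {a}" "?p \<inter> ?q \<subseteq> {a}"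
    "?ab \<inter> ?bc \<subseteq> {b}" "?ab \<inter> ?cd \<subseteq> {b}" "?ab \<inter> ?q \<subseteq> {b}" 
    "?bc \<inter> ?cd \<subseteq> {c}" "?bc \<inter> ?q \<subseteq> {c}" "?cd \<inter> ?q \<subseteq> {d}"
    using I by auto
  show "?ab \<inter> ?bc = {b}" using I' m by blast
  show "?bc \<inter> ?cd = {c}" using I' m by blast
  show "?p \<inter> ?ab = {a}" using I' m by blast
  show "?q \<inter> ?cd = {d}" using I' m by blast
  show "?ab \<inter> ?cd = {}" using I'(6) nm(5) by blast
  show "?p \<inter> ?q = {}" using I'(4) nm(3) by blast
  show "?p \<inter> ?bc = {}" using I'(2) nm(1) by blast
  show "?p \<inter> ?cd = {}" using I'(3) nm(2) by blast
  show "?q \<inter> ?ab = {}" using I'(7) nm(6) by blast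
  show "?q \<inter> ?bc = {}" using I'(9) nm(9) by blast
qed

lemma crossed_path_imp_embedding:
  assumes "crossed_path s t a b c d p ab ac bc bd cd q"
  shows "\<exists>\<phi> \<psi>. st_embedding G s t \<phi> \<psi>"
proof -
  note F = crossed_path_facts[OF assms]
  define \<phi> where "\<phi> x = (case x of Wa \<Rightarrow> a | Wb \<Rightarrow> b | Wc \<Rightarrow> c | Wd \<Rightarrow> d)" for x
  define \<psi> where "\<psi> e = (if e = (Wa, Wb) then ab else if e = (Wa, Wc) then ac
     else if e = (Wb, Wc) then bc else if e = (Wb, Wd) then bd else cd)" for e
  have \<phi>: "\<phi> Wa = a" "\<phi> Wb = b" "\<phi> Wc = c" "\<phi> Wd = d" by (auto simp: \<phi>_def)
  have \<psi>: "\<psi> (Wa, Wb) = ab" "\<psi> (Wa, Wc) = ac" "\<psi> (Wb, Wc) = bc" "\<psi> (Wb, Wd) = bd" "\<psi> (Wc, Wd) = cd"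
    by (auto simp: \<psi>_def)
  have ne: "a \<noteq> b" "a \<noteq> c" "a \<noteq> d" "b \<noteq> c" "b \<noteq> d" "c \<noteq> d" using F(8) by auto
  have inj: "inj_on \<psi> {(Wa, Wb), (Wa, Wc), (Wb, Wc), (Wb, Wd), (Wc, Wd)}"
  proof -
    \<comment> \<open>A nonempty arc list determines its two ends, and no two of the five paths have
      the same pair of ends.\<close>
    have "ab \<noteq> ac" "ab \<noteq> bc" "ab \<noteq> bd" "ab \<noteq> cd" "ac \<noteq> bc" "ac \<noteq> bd" "ac \<noteq> cd" "bc \<noteq> bd" "bc \<noteq> cd" "bd \<noteq> cd"
      using F(2-6) ne apath_ends by metis+
    then show ?thesis by (auto simp: inj_on_def \<psi>)
  qed
  have V: "{a, b, c, d} \<subseteq> verts G" using F(2,4,6) by (auto simp: apath_def)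
  have inj': "inj_on \<phi> {Wa, Wb, Wc, Wd}" by (auto simp: inj_on_def \<phi> ne ne[symmetric])
  have "st_embedding G s t \<phi> \<psi>"
    unfolding st_embedding_def wheatstone_def Let_def pre_digraph.simps
    apply (intro conjI)
    subgoal using V by (simp add: \<phi>)
    subgoal by (rule inj')
    subgoal by (rule inj)
    subgoal by (simp add: \<phi> \<psi> F(1-7))
    subgoal by (simp add: \<phi> \<psi> F(9-18) F(9-18)[THEN trans[OF Int_commute]])
    subgoal
      apply (rule exI[of _ p], rule exI[of _ q])
      apply (simp add: \<phi> \<psi> F(1,7) F(19-) Int_Un_distrib)
      done
    done
  then show ?thesis by blast
qed

end

section \<open>Minimal cuts\<close>

context wf_digraph
begin

text \<open>
  A simple path with the least number (at least two) of arcs in \<open>C\<close> is the spine of the embedding;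
  one ear lies on the source side \<open>S\<close> of the cut and the other on its target side \<open>T\<close>. They cross,
  since replacing part of the spine by an ear cannot leave two or more arcs of \<open>C\<close>.
\<close>

lemma cut_crossed_twice_imp_embedding:
  assumes cut: "\<And>p. awalk s p t \<Longrightarrow> set p \<inter> C \<noteq> {}"
    and tails: "\<And>e. e \<in> C \<Longrightarrow> \<exists>p. awalk s p (tail G e) \<and> set p \<inter> C = {}"
    and heads: "\<And>e. e \<in> C \<Longrightarrow> \<exists>p. awalk (head G e) p t \<and> set p \<inter> C = {}"
    and "apath s Q0 t" "card (set Q0 \<inter> C) \<ge> 2"
  shows "\<exists>\<phi> \<psi>. st_embedding G s t \<phi> \<psi>"
proof -
  \<comment> \<open>Nodes reachable from \<open>s\<close>, and nodes from which \<open>t\<close> is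
    reachable, without using \<open>C\<close>. They are disjoint because \<open>C\<close> is a cut;
    a node may lie in neither.\<close>
  define S where "S = {v. \<exists>p. awalk s p v \<and> set p \<inter> C = {}}"
  define T where "T = {v. \<exists>p. awalk v p t \<and> set p \<inter> C = {}}"
  have ST: "v \<notin> T" if "v \<in> S" for v
  proof
    assume "v \<in> T"
    then obtain p q where "awalk s p v" "set p \<inter> C = {}" "awalk v q t" "set q \<inter> C = {}"
      using \<open>v \<in> S\<close> by (auto simp: S_def T_def)
    then show False using cut[of "p @ q"] awalk_appendI[of s p v q t] by auto
  qed
  have S_step: "v \<in> S" if uv: "u \<in> S" "awalk u p v" "set p \<inter> C = {}" for u p v
  proof -
    obtain q where "awalk s q u" "set q \<inter> C = {}" using uv by (auto simp: S_def)
    then show "v \<in> S" using uv awalk_appendI[of s q u p v] unfolding S_def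
      by (intro CollectI exI[of _ "q @ p"]) auto
  qed
  have T_step: "u \<in> T" if uv: "v \<in> T" "awalk u p v" "set p \<inter> C = {}" for u p v
  proof -
    obtain q where "awalk v q t" "set q \<inter> C = {}" using uv by (auto simp: T_def)
    then show "u \<in> T" using uv awalk_appendI[of u p v q t] unfolding T_def
      by (intro CollectI exI[of _ "p @ q"]) auto
  qed
  have S_verts: "set (awalk_verts u p) \<subseteq> S" if uv: "u \<in> S" "awalk u p v" "set p \<inter> C = {}" for u p v
  proof
    fix w assume "w \<in> set (awalk_verts u p)"
    then obtain q r where "p = q @ r" "awalk u q w" using awalk_decomp[OF uv(2)] by blast
    then show "w \<in> S" using S_step[of u q w] uv by auto
  qed
  have T_verts: "set (awalk_verts u p) \<subseteq> T" if uv: "v \<in> T" "awalk u p v" "set p \<inter> C = {}" for u p v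
  proof
    fix w assume "w \<in> set (awalk_verts u p)"
    then obtain q r where "p = q @ r" "awalk w r v" using awalk_decomp[OF uv(2)] by blast
    then show "w \<in> T" using T_step[of v w r] uv by auto
  qed
  obtain Q where Q: "apath s Q t" "card (set Q \<inter> C) \<ge> 2"
    and Qmin: "\<And>Q'. apath s Q' t \<Longrightarrow> 2 \<le> card (set Q' \<inter> C) \<Longrightarrow> card (set Q \<inter> C) \<le> card (set Q' \<inter> C)"
    using ex_has_least_nat[of "\<lambda>Q. apath s Q t \<and> card (set Q \<inter> C) \<ge> 2" Q0 "\<lambda>Q. card (set Q \<inter> C)"]
      assms(4,5) by blast
  have sV: "s \<in> verts G" and tV: "t \<in> verts G" using Q(1) by (auto simp: apath_def)
  have sS: "s \<in> S" using sV by (auto simp: S_def awalk_Nil_iff intro!: exI[of _ "[]"])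
  have tT: "t \<in> T" using tV by (auto simp: T_def awalk_Nil_iff intro!: exI[of _ "[]"])
  have dQ: "distinct Q" using Q(1) by (rule apath_imp_distinct)
  have "\<exists>e\<in>set Q. e \<in> C" using Q(2) by (metis IntI card.empty disjoint_iff not_numeral_le_zero)
  \<comment> \<open>\<open>e\<close> is the first and \<open>f\<close> will be the last arc of
    \<open>C\<close> on the spine. \<open>Q1\<close> lies in \<open>S\<close> and \<open>Q3\<close>
    in \<open>T\<close>, whereas \<open>Q2\<close> starts in \<open>T\<close> and ends in
    \<open>S\<close>, by the hypotheses on heads and tails.\<close>
  then obtain e Q1 Q' where e: "Q = Q1 @ e # Q'" "e \<in> C" "\<forall>x\<in>set Q1. x \<notin> C"
    using split_list_first_prop[of Q "\<lambda>x. x \<in> C"] by blast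
  have "\<exists>f\<in>set Q'. f \<in> C"
  proof (rule ccontr)
    assume "\<not> ?thesis"
    then have "set Q \<inter> C = {e}" using e by auto
    with Q(2) show False by simp
  qed
  then obtain f Q2 Q3 where f: "Q' = Q2 @ f # Q3" "f \<in> C" "\<forall>x\<in>set Q3. x \<notin> C"
    using split_list_last_prop[of Q' "\<lambda>x. x \<in> C"] by blast
  have Qeq: "Q = Q1 @ e # Q2 @ f # Q3" using e f by simp
  define x where "x = tail G e" define y where "y = head G e"
  define x' where "x' = tail G f" define y' where "y' = head G f"
  have w0: "awalk s Q t" using Q(1) by (simp add: apath_def)
  have w: "awalk s Q1 x" "e \<in> arcs G" "awalk y Q2 x'" "f \<in> arcs G" "awalk y' Q3 t"
    using w0 unfolding Qeq by (auto simp: awalk_Cons_iff x_def y_def x'_def y'_def)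
  have wf': "awalk x' (f # Q3) t" using w by (simp add: awalk_Cons_iff x'_def y'_def)
  have we: "awalk y (Q2 @ f # Q3) t" using w(3) wf' by (rule awalk_appendI)
  note d1 = apath_append_verts_Int[OF Q(1)[unfolded Qeq] w(1)]
  note c1 = apath_Cons_verts[OF d1, folded y_def]
  note d2 = apath_append_verts_Int[OF c1(4) w(3)]
  note c2 = apath_Cons_verts[OF d2, folded y'_def]
  let ?V1 = "set (awalk_verts s Q1)" and ?V2 = "set (awalk_verts y Q2)" and ?V3 = "set (awalk_verts y' Q3)"
  have V23: "set (awalk_verts y (Q2 @ f # Q3)) = ?V2 \<union> ?V3"
  proof -
    have "awalk x' (f # Q3) t" by (rule wf')
    then have "set (awalk_verts y (Q2 @ f # Q3)) = ?V2 \<union> set (awalk_verts x' (f # Q3))"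
      by (rule set_awalk_verts_append[OF w(3)])
    then show ?thesis using last_in_awalk_verts[OF w(3)] by (auto simp: x'_def y'_def)
  qed
  have disj: "?V1 \<inter> ?V2 = {}" "?V1 \<inter> ?V3 = {}" "?V2 \<inter> ?V3 = {}"
    using c1(1) c2(1) unfolding V23 by blast+
  have V1S: "?V1 \<subseteq> S" by (rule S_verts[OF sS w(1)]) (use e(3) in auto)
  have V3T: "?V3 \<subseteq> T" by (rule T_verts[OF tT w(5)]) (use f(3) in auto)
  have x'S: "x' \<in> S" using tails[OF f(2)] by (auto simp: S_def x'_def)
  have yT: "y \<in> T" using heads[OF e(2)] by (auto simp: T_def y_def)
  have x'V: "x' \<in> ?V2" using w(3) by (rule last_in_awalk_verts)
  have yV: "y \<in> ?V2" using w(3) by (rule hd_in_awalk_verts)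

  \<comment> \<open>The ear \<open>R\<close> on the source side: a walk from \<open>s\<close> to
    \<open>x'\<close> that avoids \<open>C\<close> leads from \<open>Q1\<close> to a node of
    \<open>Q2\<close> in \<open>S\<close>. As \<open>R\<close> stays in \<open>S\<close>, it meets
    \<open>Q2\<close> only in \<open>c\<close> and misses \<open>Q3\<close>.\<close>
  obtain p1 where p1: "awalk s p1 x'" "set p1 \<inter> C = {}" using x'S by (auto simp: S_def)
  obtain a R c where R: "a \<in> ?V1" "c \<in> ?V2 \<inter> S" "apath a R c" "set R \<subseteq> - C"
    "set (awalk_verts a R) \<inter> ?V1 = {a}" "set (awalk_verts a R) \<inter> (?V2 \<inter> S) = {c}"
    by (rule shortest_link[OF p1(1), of "- C" ?V1 "?V2 \<inter> S"])
      (use p1(2) x'V x'S w(1) in \<open>auto simp: hd_in_awalk_verts\<close>)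
  \<comment> \<open>The mirror image on the target side: \<open>N\<close> stays in \<open>T\<close>,
    meets \<open>Q2\<close> only in \<open>b\<close>, and misses \<open>Q1\<close>.\<close>
  obtain p2 where p2: "awalk y p2 t" "set p2 \<inter> C = {}" using yT by (auto simp: T_def)
  obtain b N d where N: "b \<in> ?V2 \<inter> T" "d \<in> ?V3" "apath b N d" "set N \<subseteq> - C"
    "set (awalk_verts b N) \<inter> (?V2 \<inter> T) = {b}" "set (awalk_verts b N) \<inter> ?V3 = {d}"
    by (rule shortest_link[OF p2(1), of "- C" "?V2 \<inter> T" ?V3])
      (use p2(2) yV yT last_in_awalk_verts[OF w(5)] in \<open>auto simp: last_in_awalk_verts\<close>)
  have RS: "set (awalk_verts a R) \<subseteq> S"
    by (rule S_verts[of a R c]) (use R V1S in \<open>auto simp: apath_def\<close>)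
  have NT: "set (awalk_verts b N) \<subseteq> T"
    by (rule T_verts[of d b N]) (use N V3T in \<open>auto simp: apath_def\<close>)
  have RI: "set (awalk_verts a R) \<inter> ?V2 = {c}" "set (awalk_verts a R) \<inter> ?V3 = {}"
    using R(6) RS V3T ST by blast+
  have NI: "set (awalk_verts b N) \<inter> ?V2 = {b}" "set (awalk_verts b N) \<inter> ?V1 = {}"
    using N(5) NT V1S ST by blast+

  obtain P A where P: "Q1 = P @ A" "apath s P a" "apath a A x" "set (awalk_verts s P) \<inter> set (awalk_verts a A) = {a}"
    "?V1 = set (awalk_verts s P) \<union> set (awalk_verts a A)"
    using apath_split[OF d1(1) R(1)] by metis
  obtain B D where D: "Q3 = D @ B" "apath y' D d" "apath d B t" "set (awalk_verts y' D) \<inter> set (awalk_verts d B) = {d}"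
    "?V3 = set (awalk_verts y' D) \<union> set (awalk_verts d B)"
    using apath_split[OF c2(4) N(2)] by metis
  obtain E F where EF: "Q2 = E @ F" "apath y E c" "apath c F x'" "set (awalk_verts y E) \<inter> set (awalk_verts c F) = {c}"
    "?V2 = set (awalk_verts y E) \<union> set (awalk_verts c F)"
    using apath_split[OF d2(1), of c] R(2) by (metis IntD1)
  obtain H K where HK: "Q2 = H @ K" "apath y H b" "apath b K x'" "set (awalk_verts y H) \<inter> set (awalk_verts b K) = {b}"
    "?V2 = set (awalk_verts y H) \<union> set (awalk_verts b K)"
    using apath_split[OF d2(1), of b] N(1) by (metis IntD1)

  \<comment> \<open>Rerouting along \<open>R\<close> yields the simple path \<open>P\<close>,
    \<open>R\<close>, \<open>F\<close>, \<open>f\<close>, \<open>Q3\<close>. It misses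
    \<open>e\<close>, so it has fewer arcs of \<open>C\<close> than \<open>Q\<close>; by minimality
    it has at most one, and that is \<open>f\<close>.\<close>
  have FC: "set F \<inter> C = {}"
  proof -
    have a1: "apath s (P @ R) c" 
      by (rule apath_appendI[OF P(2) R(3)]) (use R(5) P(5) in auto)
    have v1: "set (awalk_verts s (P @ R)) \<subseteq> ?V1 \<union> set (awalk_verts a R)"
      using set_awalk_verts_append[of s P a R c] P R by (auto simp: apath_def)
    have w2: "awalk c (F @ f # Q3) t" using EF(3) wf' by (auto simp: apath_def intro: awalk_appendI)
    have a2: "apath c (F @ f # Q3) t"
      by (rule apath_append_verts_Int(2)[OF c1(4)[unfolded EF(1) append_assoc] awalkI_apath[OF EF(2)]])
    have v2: "set (awalk_verts c (F @ f # Q3)) \<subseteq> ?V2 \<union> ?V3"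
      using set_awalk_verts_append[OF awalkI_apath[OF EF(2)] w2] V23 unfolding EF(1) append_assoc by blast
    have "set (awalk_verts s (P @ R)) \<inter> set (awalk_verts c (F @ f # Q3)) \<subseteq> {c}"
      using v1 v2 disj RI by blast
    then have ap: "apath s ((P @ R) @ F @ f # Q3) t" by (rule apath_appendI[OF a1 a2])
    have sub: "set ((P @ R) @ F @ f # Q3) \<inter> C \<subseteq> (set Q \<inter> C) - {e}"
      using R(4) dQ unfolding Qeq P(1) EF(1) by auto
    have "card (set ((P @ R) @ F @ f # Q3) \<inter> C) < card (set Q \<inter> C)"
      by (rule psubset_card_mono) (use sub e(2) Qeq in auto)
    then have le: "card (set ((P @ R) @ F @ f # Q3) \<inter> C) \<le> 1" using Qmin[OF ap] by linarith
    show ?thesis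
    proof (rule ccontr)
      assume "\<not> ?thesis"
      then obtain g where g: "g \<in> set F" "g \<in> C" by auto
      then have "g \<noteq> f" using dQ unfolding Qeq EF(1) by auto
      have "card {f, g} \<le> card (set ((P @ R) @ F @ f # Q3) \<inter> C)"
        by (rule card_mono) (use g f(2) in auto)
      with \<open>g \<noteq> f\<close> le show False by simp
    qed
  qed
  \<comment> \<open>Likewise, \<open>Q1\<close>, \<open>e\<close>, \<open>H\<close>,
    \<open>N\<close>, \<open>B\<close> misses \<open>f\<close>, so \<open>e\<close> is its only arc
    of \<open>C\<close>.\<close>
  have HC: "set H \<inter> C = {}"
  proof -
    have w1: "awalk s (Q1 @ [e]) y" using w(1,2) by (intro awalk_appendI) (auto simp: awalk_simps x_def y_def)
    have v1: "set (awalk_verts s (Q1 @ [e])) = insert y ?V1"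
      using set_awalk_verts_append[OF w(1), of "[e]" y] last_in_awalk_verts[OF w(1)] w(2)
      by (auto simp: awalk_simps x_def y_def)
    have HV: "set (awalk_verts y H) \<subseteq> ?V2" using HK(5) by auto
    have a1: "apath s ((Q1 @ [e]) @ H) b"
      by (rule apath_appendI[OF c1(5) HK(2)]) (use v1 disj HV in auto)
    have v2: "set (awalk_verts s ((Q1 @ [e]) @ H)) \<subseteq> ?V1 \<union> ?V2"
      using set_awalk_verts_append[OF w1, of H b] HK(2) HV yV v1 by (auto simp: apath_def)
    have v3: "set (awalk_verts d B) \<subseteq> ?V3" using D(5) by auto
    have a2: "apath b (N @ B) t"
      by (rule apath_appendI[OF N(3) D(3)]) (use v3 N(6) in auto)
    have v4: "set (awalk_verts b (N @ B)) \<subseteq> set (awalk_verts b N) \<union> ?V3"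
      using set_awalk_verts_append[of b N d B t] N(3) D(3) v3 by (auto simp: apath_def)
    have "set (awalk_verts s ((Q1 @ [e]) @ H)) \<inter> set (awalk_verts b (N @ B)) \<subseteq> {b}"
      using v2 v4 disj NI by blast
    then have ap: "apath s (((Q1 @ [e]) @ H) @ N @ B) t" by (rule apath_appendI[OF a1 a2])
    have sub: "set (((Q1 @ [e]) @ H) @ N @ B) \<inter> C \<subseteq> (set Q \<inter> C) - {f}"
      using N(4) dQ unfolding Qeq HK(1) D(1) by auto
    have "card (set (((Q1 @ [e]) @ H) @ N @ B) \<inter> C) < card (set Q \<inter> C)"
      by (rule psubset_card_mono) (use sub f(2) Qeq in auto)
    then have le: "card (set (((Q1 @ [e]) @ H) @ N @ B) \<inter> C) \<le> 1" using Qmin[OF ap] by linarith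
    show ?thesis
    proof (rule ccontr)
      assume "\<not> ?thesis"
      then obtain g where g: "g \<in> set H" "g \<in> C" by auto
      then have "g \<noteq> e" using dQ unfolding Qeq HK(1) by auto
      have "card {e, g} \<le> card (set (((Q1 @ [e]) @ H) @ N @ B) \<inter> C)"
        by (rule card_mono) (use g e(2) in auto)
      with \<open>g \<noteq> e\<close> le show False by simp
    qed
  qed
  \<comment> \<open>So \<open>b\<close> precedes \<open>c\<close> on \<open>Q2\<close>: otherwise
    the stretch from \<open>c\<close> to \<open>b\<close> is an initial part of \<open>F\<close>,
    avoids \<open>C\<close>, and puts \<open>b\<close> into \<open>S\<close> although
    \<open>b\<close> is in \<open>T\<close>.\<close>
  have "\<not> (H = E @ m \<and> F = m @ K)" for m
  proof
    assume m: "H = E @ m \<and> F = m @ K"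
    have "awlast y E = c" using EF(2) by (auto simp: apath_def)
    then have "awalk c m b" using HK(2) m by (auto simp: apath_def)
    then have "b \<in> S" using S_step[of c m b] R(2) FC m by auto
    then show False using ST N(1) by blast
  qed
  moreover have "E @ F = H @ K" using EF(1) HK(1) by simp
  ultimately obtain M where M: "E = H @ M" "K = M @ F"
    unfolding append_eq_append_conv2 by auto
  have "awlast y H = b" using HK(2) by (auto simp: apath_def)
  then have wM: "awalk b M c" using EF(2) unfolding M(1) by (auto simp: apath_def)
  have bc: "b \<noteq> c" using R(2) N(1) ST by blast
  \<comment> \<open>The spine divided at \<open>a\<close>, \<open>b\<close>, \<open>c\<close>,
    \<open>d\<close>; \<open>e\<close> lies between \<open>a\<close> and \<open>b\<close>, and
    \<open>f\<close> between \<open>c\<close> and \<open>d\<close>.\<close>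
  have spine: "P @ (A @ e # H) @ M @ (F @ f # D) @ B = Q" unfolding Qeq P(1) D(1) EF(1) M(1) by simp
  have VQ: "set (awalk_verts s Q) = ?V1 \<union> ?V2 \<union> ?V3"
  proof -
    have "awalk x (e # Q2 @ f # Q3) t" using w(2) we by (simp del: awalk_append_iff add: awalk_Cons_iff x_def y_def)
    from set_awalk_verts_append[OF w(1) this] show ?thesis unfolding Qeq
      using last_in_awalk_verts[OF w(1)] V23 by (auto simp: x_def y_def)
  qed
  have "crossed_path s t a b c d P (A @ e # H) R M N (F @ f # D) B"
    unfolding crossed_path_def spine VQ
  proof (intro conjI)
    show "M \<noteq> []" using wM bc by (auto simp: awalk_Nil_iff)
    show "awalk a (A @ e # H) b"
      using P(3) HK(2) w(2) by (intro awalk_appendI[of a A x]) (auto simp: apath_def awalk_Cons_iff x_def y_def)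
    show "awalk c (F @ f # D) d"
      using EF(3) D(2) w(4) by (intro awalk_appendI[of c F x']) (auto simp: apath_def awalk_Cons_iff x'_def y'_def)
    show "set (awalk_verts a R) \<inter> (?V1 \<union> ?V2 \<union> ?V3) = {a, c}"
      unfolding Int_Un_distrib R(5) RI by auto
    show "set (awalk_verts b N) \<inter> (?V1 \<union> ?V2 \<union> ?V3) = {b, d}"
      unfolding Int_Un_distrib N(6) NI by auto
    show "set (awalk_verts a R) \<inter> set (awalk_verts b N) = {}" using RS NT ST by blast
  qed (simp_all add: Q(1) awalkI_apath[OF P(2)] wM awalkI_apath[OF D(3)] R(3) N(3))
  then show ?thesis by (rule crossed_path_imp_embedding)
qed

text \<open>\<open>C\<close> is a cut of least size inside \<open>B\<close>. Its minimality puts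
  every arc of \<open>C\<close> on an \<open>st\<close>-path free of other arcs of \<open>C\<close>,
  which provides the walks required for an embedding as soon as some simple path meets
  \<open>C\<close> twice.\<close>

lemma min_cut_crossed_once_or_embedding:
  assumes "finite B" and cut: "\<And>p. awalk s p t \<Longrightarrow> set p \<inter> B \<noteq> {}"
    and no: "\<nexists>\<phi> \<psi>. st_embedding G s t \<phi> \<psi>"
  obtains C where "C \<subseteq> B" "\<And>p. apath s p t \<Longrightarrow> card (set p \<inter> C) = 1"
proof -
  define Z where "Z C \<longleftrightarrow> C \<subseteq> B \<and> (\<forall>p. awalk s p t \<longrightarrow> set p \<inter> C \<noteq> {})" for C
  have "Z B" using cut by (auto simp: Z_def)
  then obtain C where C: "Z C" and min: "\<And>C'. Z C' \<Longrightarrow> card C \<le> card C'"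
    using ex_has_least_nat[of Z B card] by blast
  have fin: "finite C" using C \<open>finite B\<close> by (auto simp: Z_def intro: finite_subset)
  have through: "\<exists>p q. awalk s p (tail G e) \<and> awalk (head G e) q t \<and> set p \<inter> C = {} \<and> set q \<inter> C = {}"
    if e: "e \<in> C" for e
  proof -
    \<comment> \<open>Without \<open>e\<close> the set is no longer a cut, so some path avoids all
      of \<open>C\<close> except \<open>e\<close>, and it must pass through
      \<open>e\<close>.\<close>
    have "\<not> Z (C - {e})" using min[of "C - {e}"] fin e by (metis card_Diff1_less not_le)
    then obtain r where r: "awalk s r t" "set r \<inter> (C - {e}) = {}" using C by (auto simp: Z_def)
    define r' where "r' = awalk_to_apath r"
    have r': "apath s r' t" "set r' \<inter> (C - {e}) = {}" 
      using apath_awalk_to_apath[OF r(1)] awalk_to_apath_subset[OF r(1)] r(2) by (auto simp: r'_def)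
    then have "set r' \<inter> C \<noteq> {}" using C by (auto simp: Z_def apath_def)
    then have "e \<in> set r'" using r'(2) by blast
    then obtain p q where pq: "r' = p @ e # q" by (auto simp: in_set_conv_decomp)
    have "distinct r'" using r'(1) by (rule apath_imp_distinct)
    then have "set p \<inter> C = {}" "set q \<inter> C = {}" using r'(2) unfolding pq by auto
    moreover have "awalk s p (tail G e)" "awalk (head G e) q t"
      using r'(1) unfolding pq by (auto simp: apath_def awalk_Cons_iff)
    ultimately show ?thesis by blast
  qed
  have "card (set p \<inter> C) = 1" if p: "apath s p t" for p
  proof -
    have "\<not> card (set p \<inter> C) \<ge> 2"
    proof
      assume "card (set p \<inter> C) \<ge> 2"
      then have "\<exists>\<phi> \<psi>. st_embedding G s t \<phi> \<psi>"
        using cut_crossed_twice_imp_embedding[of s t C p] C through p unfolding Z_def by meson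
      with no show False by blast
    qed
    moreover have "set p \<inter> C \<noteq> {}" using C p by (auto simp: Z_def apath_def)
    then have "card (set p \<inter> C) \<noteq> 0" by simp
    ultimately show ?thesis by linarith
  qed
  moreover have "C \<subseteq> B" using C by (simp add: Z_def)
  ultimately show thesis using that by blast
qed

end

section \<open>Wardrop flows\<close>

lemma sum_set_le_sum_list:
  fixes f :: "'b \<Rightarrow> real"
  assumes "\<And>x. x \<in> set xs \<Longrightarrow> f x \<ge> 0"
  shows "sum f (set xs) \<le> sum_list (map f xs)"
  using assms
proof (induction xs)
  case (Cons x xs)
  then have "sum f (set xs) \<le> sum_list (map f xs)" "f x \<ge> 0" by auto
  then show ?case by (cases "x \<in> set xs") (auto simp: insert_absorb)
qed simp

lemma latency_fun_mono:
  assumes "latency_fun G l" "e \<in> arcs G" "0 \<le> x" "x \<le> y"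
  shows "l e x \<le> l e y"
  using assms by (auto simp: latency_fun_def mono_on_def)

lemma latency_fun_nonneg:
  assumes "latency_fun G l" "e \<in> arcs G" "0 \<le> x"
  shows "0 \<le> l e x"
  using assms by (auto simp: latency_fun_def)

context st_net
begin

section \<open>Arc flows and path latencies\<close>

lemma finite_SP [simp]: "finite (SP G s t)"
  using apaths_finite by (simp add: SP_def)

lemma SP_D:
  assumes "p \<in> SP G s t"
  shows "p \<in> st_paths G s t" "set p \<subseteq> arcs G" "distinct p"
  using assms apath_imp_distinct by (auto simp: SP_def st_paths_def apath_def)

lemma is_flow_nonneg: "is_flow G s t \<phi> \<Longrightarrow> 0 \<le> \<phi> p"
  by (cases "p \<in> SP G s t") (auto simp: is_flow_def)

lemma is_flow_pos_SP: "is_flow G s t \<phi> \<Longrightarrow> \<phi> p > 0 \<Longrightarrow> p \<in> SP G s t"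
  by (cases "p \<in> SP G s t") (auto simp: is_flow_def)

lemma arc_flow_nonneg: "is_flow G s t \<phi> \<Longrightarrow> 0 \<le> arc_flow G s t \<phi> e"
  by (auto simp: arc_flow_def is_flow_def intro: sum_nonneg)

lemma arc_flow_conv: "arc_flow G s t \<phi> e = (\<Sum>p\<in>SP G s t. \<phi> p * indicator (set p) e)"
  unfolding arc_flow_def by (auto intro!: sum.mono_neutral_cong_left)

lemma arc_flow_pos_path:
  assumes "is_flow G s t \<phi>" "arc_flow G s t \<phi> e > 0"
  obtains p where "p \<in> SP G s t" "e \<in> set p" "\<phi> p > 0"
proof -
  have "\<exists>p\<in>{p \<in> SP G s t. e \<in> set p}. \<phi> p > 0"
    using assms(2) unfolding arc_flow_def by (meson not_less sum_nonpos)
  then show thesis using that by auto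
qed

text \<open>Double counting over pairs of an arc and a path through it. With \<open>w\<close>
  constantly \<open>1\<close> it measures the flow across a cut, with \<open>w\<close> the arc
  latencies the total cost.\<close>

lemma sum_arc_flow_mult:
  assumes "finite A"
  shows "(\<Sum>e\<in>A. arc_flow G s t \<phi> e * w e) = (\<Sum>p\<in>SP G s t. \<phi> p * (\<Sum>e\<in>A \<inter> set p. w e))"
proof -
  have "(\<Sum>e\<in>A. arc_flow G s t \<phi> e * w e) = (\<Sum>e\<in>A. \<Sum>p\<in>SP G s t. \<phi> p * (indicator (set p) e * w e))"
    unfolding arc_flow_conv sum_distrib_right by (simp only: mult.assoc)
  also have "\<dots> = (\<Sum>p\<in>SP G s t. \<phi> p * (\<Sum>e\<in>A. indicator (set p) e * w e))"
    by (subst sum.swap) (simp add: sum_distrib_left)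
  also have "\<dots> = (\<Sum>p\<in>SP G s t. \<phi> p * (\<Sum>e\<in>A \<inter> set p. w e))"
    using assms by (simp add: sum_indicator_mult Int_def)
  finally show ?thesis .
qed

lemma path_latency_SP:
  assumes "p \<in> SP G s t"
  shows "path_latency G s t l \<phi> p = (\<Sum>e\<in>set p. l e (arc_flow G s t \<phi> e))"
  using SP_D(3)[OF assms] by (simp add: path_latency_def sum_list_distinct_conv_sum_set)

text \<open>Removing cycles only discards arcs of nonnegative latency, so comparing with simple
  paths is enough to compare with all paths.\<close>

lemma shorter_simple_path:
  assumes "latency_fun G l" "is_flow G s t \<phi>" "p \<in> st_paths G s t"
  obtains q where "q \<in> SP G s t" "set q \<subseteq> set p" "path_latency G s t l \<phi> q \<le> path_latency G s t l \<phi> p"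
proof -
  define q where "q = awalk_to_apath p"
  have p: "awalk s p t" using assms by (simp add: st_paths_def)
  have q: "q \<in> SP G s t" "set q \<subseteq> set p"
    using apath_awalk_to_apath[OF p] awalk_to_apath_subset[OF p] by (auto simp: SP_def q_def)
  have pos: "0 \<le> l e (arc_flow G s t \<phi> e)" if "e \<in> set p" for e
    using that p latency_fun_nonneg[OF assms(1)] arc_flow_nonneg[OF assms(2)] by blast
  have "path_latency G s t l \<phi> q \<le> (\<Sum>e\<in>set p. l e (arc_flow G s t \<phi> e))"
    unfolding path_latency_SP[OF q(1)] using q(2) pos by (intro sum_mono2) auto
  also have "\<dots> \<le> path_latency G s t l \<phi> p"
    unfolding path_latency_def using pos by (intro sum_set_le_sum_list) auto
  finally show thesis using that q by blast
qed

text \<open>The variational inequality for Wardrop flows. With all latencies frozen at \<phi>, every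
  path used by \<phi> has the least latency, so no flow of the same value is cheaper.\<close>

lemma wardrop_flow_total_latency:
  assumes \<phi>: "wardrop_flow G s t r l \<phi>" "\<phi> p > 0"
    and \<psi>: "is_flow G s t \<psi>" "flow_value G s t \<psi> = r"
  shows "(\<Sum>e\<in>arcs G. arc_flow G s t \<phi> e * l e (arc_flow G s t \<phi> e))
    \<le> (\<Sum>e\<in>arcs G. arc_flow G s t \<psi> e * l e (arc_flow G s t \<phi> e))"
proof -
  have f: "is_flow G s t \<phi>" "flow_value G s t \<phi> = r" using \<phi> by (auto simp: wardrop_flow_def)
  have p: "p \<in> SP G s t" using f \<phi> is_flow_pos_SP by auto
  let ?m = "path_latency G s t l \<phi> p"
  have conv: "(\<Sum>e\<in>arcs G. arc_flow G s t \<xi> e * l e (arc_flow G s t \<phi> e))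
      = (\<Sum>q\<in>SP G s t. \<xi> q * path_latency G s t l \<phi> q)" for \<xi>
    unfolding sum_arc_flow_mult[OF finite_arcs]
    by (intro sum.cong refl) (simp add: path_latency_SP Int_absorb1 SP_D(2))
  have "(\<Sum>q\<in>SP G s t. \<phi> q * path_latency G s t l \<phi> q) = (\<Sum>q\<in>SP G s t. \<phi> q * ?m)"
  proof (intro sum.cong refl)
    fix q assume q: "q \<in> SP G s t"
    show "\<phi> q * path_latency G s t l \<phi> q = \<phi> q * ?m"
    proof (cases "\<phi> q > 0")
      case True
      then have "path_latency G s t l \<phi> q = ?m"
        using \<phi> SP_D(1)[OF q] SP_D(1)[OF p] unfolding wardrop_flow_def by (intro antisym) blast+
      then show ?thesis by simp
    qed (use is_flow_nonneg[OF f(1), of q] in simp)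
  qed
  also have "\<dots> = (\<Sum>q\<in>SP G s t. \<psi> q * ?m)"
    using f(2) \<psi>(2) by (simp add: flow_value_def flip: sum_distrib_right)
  also have "\<dots> \<le> (\<Sum>q\<in>SP G s t. \<psi> q * path_latency G s t l \<phi> q)"
    using \<phi> is_flow_nonneg[OF \<psi>(1)] SP_D(1) SP_D(1)[OF p] unfolding wardrop_flow_def
    by (intro sum_mono mult_left_mono) blast+
  finally show ?thesis unfolding conv .
qed

text \<open>Adding the variational inequalities of the two flows gives a sum at most zero, whose
  terms are nonnegative by monotonicity. So every term vanishes: the arc flows agree or the
  latencies do.\<close>

lemma wardrop_flow_arc_latency_unique:
  assumes l: "latency_fun G l"
    and \<phi>: "wardrop_flow G s t r l \<phi>" "\<phi> p > 0" and \<psi>: "wardrop_flow G s t r l \<psi>" "\<psi> q > 0"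
    and e: "e \<in> arcs G"
  shows "l e (arc_flow G s t \<phi> e) = l e (arc_flow G s t \<psi> e)"
proof -
  let ?x = "arc_flow G s t \<phi>" and ?y = "arc_flow G s t \<psi>"
  have f: "is_flow G s t \<phi>" "flow_value G s t \<phi> = r" "is_flow G s t \<psi>" "flow_value G s t \<psi> = r"
    using \<phi> \<psi> by (auto simp: wardrop_flow_def)
  have nn: "(?x e - ?y e) * (l e (?x e) - l e (?y e)) \<ge> 0" if "e \<in> arcs G" for e
  proof (cases "?x e \<le> ?y e")
    case True
    then have "l e (?x e) \<le> l e (?y e)" using latency_fun_mono[OF l that] arc_flow_nonneg[OF f(1)] by blast
    with True show ?thesis by (simp add: mult_nonpos_nonpos)
  next
    case False
    then have "l e (?y e) \<le> l e (?x e)" using latency_fun_mono[OF l that] arc_flow_nonneg[OF f(3)] by simp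
    with False show ?thesis by simp
  qed
  have "(\<Sum>e\<in>arcs G. (?x e - ?y e) * (l e (?x e) - l e (?y e)))
      = ((\<Sum>e\<in>arcs G. ?x e * l e (?x e)) - (\<Sum>e\<in>arcs G. ?y e * l e (?x e)))
        + ((\<Sum>e\<in>arcs G. ?y e * l e (?y e)) - (\<Sum>e\<in>arcs G. ?x e * l e (?y e)))"
    by (simp add: algebra_simps sum.distrib sum_subtractf)
  also have "\<dots> \<le> 0"
    using wardrop_flow_total_latency[OF \<phi> f(3,4)] wardrop_flow_total_latency[OF \<psi> f(1,2)] by linarith
  finally have "(\<Sum>e\<in>arcs G. (?x e - ?y e) * (l e (?x e) - l e (?y e))) = 0"
    using nn by (intro antisym sum_nonneg) auto
  then have "(?x e - ?y e) * (l e (?x e) - l e (?y e)) = 0"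
    using nn e by (subst (asm) sum_nonneg_eq_0_iff) auto
  then show ?thesis by auto
qed

text \<open>Arc latencies agree in any two Wardrop flows, hence so do the latencies of simple paths;
  thus the definite description in \<open>wardrop_latency\<close> denotes the common
  latency.\<close>

lemma wardrop_latency_eq:
  assumes l: "latency_fun G l" and r: "r > 0" and \<phi>: "wardrop_flow G s t r l \<phi>" "\<phi> p > 0"
  shows "wardrop_latency G s t r l = path_latency G s t l \<phi> p"
proof -
  have p: "p \<in> SP G s t" using \<phi> is_flow_pos_SP by (auto simp: wardrop_flow_def)
  have "x = path_latency G s t l \<phi> p"
    if "wardrop_flow G s t r l \<psi>" "q \<in> st_paths G s t" "\<psi> q > 0" "x = path_latency G s t l \<psi> q" for x \<psi> q
  proof -
    have q: "q \<in> SP G s t" using that is_flow_pos_SP by (auto simp: wardrop_flow_def)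
    have eq: "path_latency G s t l \<phi> q' = path_latency G s t l \<psi> q'" if "q' \<in> SP G s t" for q'
      unfolding path_latency_SP[OF that] using SP_D(2)[OF that]
      by (intro sum.cong refl wardrop_flow_arc_latency_unique[OF l \<phi> \<open>wardrop_flow G s t r l \<psi>\<close> \<open>\<psi> q > 0\<close>]) auto
    have "path_latency G s t l \<psi> q \<le> path_latency G s t l \<psi> p"
      "path_latency G s t l \<phi> p \<le> path_latency G s t l \<phi> q"
      using that \<phi> SP_D(1)[OF p] unfolding wardrop_flow_def by blast+
    with eq[OF p] eq[OF q] that(4) show ?thesis by simp
  qed
  then have "(THE x. \<exists>\<phi>. wardrop_flow G s t r l \<phi> \<and> (\<exists>p\<in>st_paths G s t. \<phi> p > 0 \<and> x = path_latency G s t l \<phi> p))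
    = path_latency G s t l \<phi> p"
    by (intro the_equality exI[of _ \<phi>] conjI bexI[of _ p]) (use \<phi> SP_D(1)[OF p] in blast)+
  with r show ?thesis by (simp add: wardrop_latency_def)
qed

lemma positive_flow_path:
  assumes "flow_value G s t \<phi> > 0"
  obtains p where "p \<in> SP G s t" "\<phi> p > 0"
proof -
  have "\<exists>p\<in>SP G s t. \<phi> p > 0"
    using assms unfolding flow_value_def by (meson not_less sum_nonpos)
  then show thesis using that by blast
qed

end


subsection \<open>Existence of Wardrop flows\<close>

lemma continuous_antiderivative:
  fixes f :: "real \<Rightarrow> real"
  assumes "continuous_on UNIV f"
  obtains F where "\<And>x. (F has_real_derivative f x) (at x)"
  using einterval_antiderivative[of "-\<infinity>" \<infinity> f] assms
  by (auto simp: has_real_derivative_iff_has_vector_derivative continuous_on_eq_continuous_at)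

text \<open>A closed subset of a product of the compact sets \<open>{0..r}\<close> and
  \<open>{0}\<close>. The index type may be infinite, so compactness of the product is Tychonoff's
  theorem.\<close>

lemma compact_nonneg_sum_eq:
  fixes X :: "'b set"
  assumes "finite X"
  shows "compact {\<phi> :: 'b \<Rightarrow> real. (\<forall>p\<in>X. 0 \<le> \<phi> p) \<and> (\<forall>p. p \<notin> X \<longrightarrow> \<phi> p = 0) \<and> (\<Sum>p\<in>X. \<phi> p) = r}"
proof -
  let ?K = "{\<phi> :: 'b \<Rightarrow> real. (\<forall>p\<in>X. 0 \<le> \<phi> p) \<and> (\<forall>p. p \<notin> X \<longrightarrow> \<phi> p = 0) \<and> (\<Sum>p\<in>X. \<phi> p) = r}"
  let ?B = "\<lambda>p. if p \<in> X then {0..r} else {0::real}"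
  have "compact (PiE UNIV ?B)"
    unfolding compactin_euclidean_iff[symmetric] euclidean_product_topology[symmetric] compactin_PiE
    by (auto simp: compactin_euclidean_iff)
  moreover have "closed ?K"
  proof -
    have c: "continuous_on UNIV (\<lambda>\<phi> :: 'b \<Rightarrow> real. \<phi> p)" for p by (rule continuous_on_product_coordinates)
    have "closed ({\<phi>. \<forall>p. p \<in> X \<longrightarrow> 0 \<le> \<phi> p} \<inter> {\<phi>. \<forall>p. p \<notin> X \<longrightarrow> \<phi> p = 0} \<inter> {\<phi> :: 'b \<Rightarrow> real. (\<Sum>p\<in>X. \<phi> p) = r})"
      by (intro closed_Int closed_Collect_all closed_Collect_imp closed_Collect_le closed_Collect_eq
          continuous_intros c) auto
    moreover have "?K = {\<phi>. \<forall>p. p \<in> X \<longrightarrow> 0 \<le> \<phi> p} \<inter> {\<phi>. \<forall>p. p \<notin> X \<longrightarrow> \<phi> p = 0} \<inter> {\<phi> :: 'b \<Rightarrow> real. (\<Sum>p\<in>X. \<phi> p) = r}"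
      by auto
    ultimately show ?thesis by simp
  qed
  moreover have "?K \<subseteq> PiE UNIV ?B"
  proof
    fix \<phi> assume \<phi>: "\<phi> \<in> ?K"
    have "\<phi> p \<le> r" if "p \<in> X" for p
      using \<phi> member_le_sum[of p X \<phi>] assms that by auto
    with \<phi> show "\<phi> \<in> PiE UNIV ?B" by auto
  qed
  ultimately show ?thesis using compact_Int_closed[of "PiE UNIV ?B" ?K] by (simp add: Int_absorb1)
qed

context st_net
begin

text \<open>
  A minimiser of Beckmann's potential (the sum over all arcs \<open>e\<close> of an antiderivative of \<open>l e\<close>,
  taken at the flow through \<open>e\<close>) is a Wardrop flow: moving flow from a used path \<open>p\<close> to a path \<open>q\<close>
  changes the potential at the rate \<open>path_latency q - path_latency p\<close>.
\<close>

lemma wardrop_flow_exists: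
  assumes l: "latency_fun G l" and r: "r \<ge> 0" and ne: "SP G s t \<noteq> {}"
  shows "\<exists>\<phi>. wardrop_flow G s t r l \<phi>"
proof -
  let ?X = "SP G s t" and ?af = "arc_flow G s t"
  define K where "K = {\<phi>. (\<forall>p\<in>?X. 0 \<le> \<phi> p) \<and> (\<forall>p. p \<notin> ?X \<longrightarrow> \<phi> p = 0) \<and> (\<Sum>p\<in>?X. \<phi> p) = r}"
  have K_iff: "\<phi> \<in> K \<longleftrightarrow> is_flow G s t \<phi> \<and> flow_value G s t \<phi> = r" for \<phi>
    by (auto simp: K_def is_flow_def flow_value_def)
  \<comment> \<open>\<open>l e\<close> is controlled only on the nonnegative reals; composing it
    with \<open>max 0\<close> continues it as a constant to the left, so an antiderivative exists on
    the whole line.\<close>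
  have "\<exists>F. \<forall>x. (F has_real_derivative l e (max 0 x)) (at x)" if "e \<in> arcs G" for e
  proof -
    have "continuous_on UNIV (\<lambda>x. l e (max 0 x))"
      by (rule continuous_on_compose2[of "{0..}" "l e" UNIV "max 0"])
        (use l that in \<open>auto simp: latency_fun_def intro!: continuous_intros\<close>)
    then show ?thesis using continuous_antiderivative by metis
  qed
  then obtain F where F: "\<And>e x. e \<in> arcs G \<Longrightarrow> (F e has_real_derivative l e (max 0 x)) (at x)"
    by metis
  define \<Phi> where "\<Phi> \<phi> = (\<Sum>e\<in>arcs G. F e (?af \<phi> e))" for \<phi>
  have "continuous_on K \<Phi>"
    unfolding \<Phi>_def
  proof (intro continuous_on_sum)
    fix e assume e: "e \<in> arcs G"
    have "continuous_on UNIV (F e)"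
      using F[OF e] by (intro DERIV_continuous_on) (auto intro: has_field_derivative_at_within)
    moreover have "continuous_on K (\<lambda>\<phi>. ?af \<phi> e)"
      unfolding arc_flow_conv
      by (intro continuous_intros continuous_on_subset[OF continuous_on_product_coordinates]) auto
    ultimately show "continuous_on K (\<lambda>\<phi>. F e (?af \<phi> e))"
      by (rule continuous_on_compose2) auto
  qed
  moreover have "compact K" unfolding K_def by (rule compact_nonneg_sum_eq) simp
  moreover have "K \<noteq> {}"
  proof -
    obtain p0 where "p0 \<in> ?X" using ne by auto
    then have "(\<lambda>p. if p = p0 then r else 0) \<in> K" using r by (auto simp: K_def)
    then show ?thesis by blast
  qed
  ultimately obtain \<phi> where \<phi>: "\<phi> \<in> K" and min: "\<And>\<psi>. \<psi> \<in> K \<Longrightarrow> \<Phi> \<phi> \<le> \<Phi> \<psi>"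
    using continuous_attains_inf[of K \<Phi>] by blast
  have f: "is_flow G s t \<phi>" "flow_value G s t \<phi> = r" using \<phi> K_iff by auto
  have SP_le: "path_latency G s t l \<phi> p \<le> path_latency G s t l \<phi> q" if p: "\<phi> p > 0" and q: "q \<in> ?X" for p q
  proof (rule ccontr)
    assume less: "\<not> ?thesis"
    have pX: "p \<in> ?X" using f(1) p by (rule is_flow_pos_SP)
    have pq: "p \<noteq> q" using less by auto
    \<comment> \<open>\<delta> is the change of the arc flows per unit of flow moved from
      \<open>p\<close> to \<open>q\<close>; it vanishes on arcs of both paths and on arcs of
      neither.\<close>
    define \<delta> where "\<delta> e = (indicator (set q) e - indicator (set p) e :: real)" for e
    define \<psi> where "\<psi> h = \<phi>(p := \<phi> p - h, q := \<phi> q + h)" for h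
    have af: "?af (\<psi> h) e = ?af \<phi> e + h * \<delta> e" for h e
    proof -
      have *: "\<psi> h x * indicator (set x) e = \<phi> x * indicator (set x) e
        + ((if x = q then h * indicator (set x) e else 0) - (if x = p then h * indicator (set x) e else 0))" for x
        using pq by (auto simp: \<psi>_def algebra_simps)
      show ?thesis
        unfolding arc_flow_conv * sum.distrib sum_subtractf using pX q
        by (simp add: \<delta>_def algebra_simps)
    qed
    have \<psi>K: "\<psi> h \<in> K" if h: "0 \<le> h" "h \<le> \<phi> p" for h
    proof -
      have "\<psi> h x = \<phi> x + ((if x = q then h else 0) - (if x = p then h else 0))" for x
        using pq by (auto simp: \<psi>_def)
      then have "(\<Sum>x\<in>?X. \<psi> h x) = (\<Sum>x\<in>?X. \<phi> x)" using pX q by (simp add: sum.distrib sum_subtractf)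
      with \<phi> h pX q show ?thesis by (auto simp: K_def \<psi>_def)
    qed
    \<comment> \<open>For negative \<open>h\<close>, \<open>\<psi> h\<close> may fail to be a flow,
      but the potential is still defined, so \<open>g\<close> has a two-sided derivative at
      \<open>0\<close>.\<close>
    define g where "g h = \<Phi> (\<psi> h)" for h
    have "(g has_real_derivative (\<Sum>e\<in>arcs G. l e (?af \<phi> e) * \<delta> e)) (at 0)"
      unfolding g_def \<Phi>_def af
    proof (rule DERIV_sum)
      fix e assume e: "e \<in> arcs G"
      have 1: "(F e has_real_derivative l e (?af \<phi> e)) (at (?af \<phi> e + 0 * \<delta> e))"
        using F[OF e, of "?af \<phi> e"] arc_flow_nonneg[OF f(1), of e] by (simp add: max_def)
      have 2: "((\<lambda>h. ?af \<phi> e + h * \<delta> e) has_real_derivative \<delta> e) (at 0)"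
        by (auto intro!: derivative_eq_intros)
      show "((\<lambda>h. F e (?af \<phi> e + h * \<delta> e)) has_real_derivative l e (?af \<phi> e) * \<delta> e) (at 0)"
        by (rule DERIV_chain2[OF 1 2])
    qed
    moreover have "(\<Sum>e\<in>arcs G. l e (?af \<phi> e) * \<delta> e) = path_latency G s t l \<phi> q - path_latency G s t l \<phi> p"
    proof -
      have "(\<Sum>e\<in>arcs G. l e (?af \<phi> e) * indicator (set x) e) = path_latency G s t l \<phi> x" if "x \<in> ?X" for x
        using SP_D(2)[OF that] by (auto simp: path_latency_SP[OF that] sum_mult_indicator intro!: sum.cong)
      with pX q show ?thesis by (simp add: \<delta>_def right_diff_distrib sum_subtractf)
    qed
    ultimately obtain d where d: "d > 0" "\<And>h. 0 < h \<Longrightarrow> h < d \<Longrightarrow> g (0 + h) < g 0"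
      using DERIV_neg_dec_right[of g "path_latency G s t l \<phi> q - path_latency G s t l \<phi> p" 0] less by auto
    \<comment> \<open>The bound \<open>\<phi> p\<close> keeps \<open>\<psi> h\<close> nonnegative,
      and half of \<open>d\<close> stays strictly below \<open>d\<close>.\<close>
    define h where "h = min (d / 2) (\<phi> p)"
    have h: "0 < h" "h < d" "h \<le> \<phi> p" using d(1) p by (auto simp: h_def)
    have "\<psi> 0 = \<phi>" by (auto simp: \<psi>_def)
    then have "g 0 \<le> g h" using min[OF \<psi>K[of h]] h by (simp add: g_def)
    with d(2)[OF h(1,2)] show False by simp
  qed
  have "path_latency G s t l \<phi> p \<le> path_latency G s t l \<phi> q" if p: "\<phi> p > 0" and q: "q \<in> st_paths G s t" for p q
  proof -
    obtain q' where "q' \<in> ?X" "path_latency G s t l \<phi> q' \<le> path_latency G s t l \<phi> q"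
      using shorter_simple_path[OF l f(1) q] by metis
    with SP_le[OF p, of q'] show ?thesis by linarith
  qed
  with f show ?thesis unfolding wardrop_flow_def by blast
qed

end

section \<open>Nets without an embedding are not vulnerable\<close>

context st_net
begin

section \<open>Shortest walks under a Wardrop flow\<close>

lemma path_latency_append:
  "path_latency G s t l \<phi> (p @ q) = path_latency G s t l \<phi> p + path_latency G s t l \<phi> q"
  by (simp add: path_latency_def)

lemma path_latency_nonneg:
  assumes "latency_fun G l" "is_flow G s t \<phi>" "set p \<subseteq> arcs G"
  shows "0 \<le> path_latency G s t l \<phi> p"
  unfolding path_latency_def
  using assms latency_fun_nonneg[OF assms(1)] arc_flow_nonneg[OF assms(2)] by (intro sum_list_nonneg) auto

text \<open>The arcs of \<open>p\<close> may lie on different used paths. Let the last arc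
  \<open>e\<close> lie on a used path \<open>q1\<close>, \<open>e\<close>, \<open>q2\<close>: by
  induction the rest of \<open>p\<close> has at most the latency of \<open>q1\<close>, and replacing
  \<open>q1\<close>, \<open>e\<close> by \<open>x\<close> cannot lower the latency of that
  path.\<close>

lemma positive_flow_walk_shortest:
  assumes l: "latency_fun G l" and \<phi>: "wardrop_flow G s t r l \<phi>"
    and "awalk s p v" "\<And>e. e \<in> set p \<Longrightarrow> arc_flow G s t \<phi> e > 0" "awalk s x v"
  shows "path_latency G s t l \<phi> p \<le> path_latency G s t l \<phi> x"
  using assms(3-)
proof (induction p arbitrary: v x rule: rev_induct)
  case Nil
  have "is_flow G s t \<phi>" using \<phi> by (simp add: wardrop_flow_def)
  moreover have "set x \<subseteq> arcs G" using Nil.prems(3) by blast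
  ultimately have "0 \<le> path_latency G s t l \<phi> x" using path_latency_nonneg[OF l] by blast
  then show ?case by (simp add: path_latency_def)
next
  case (snoc e p)
  have f: "is_flow G s t \<phi>" using \<phi> by (simp add: wardrop_flow_def)
  have e: "awalk s p (tail G e)" "head G e = v"
    using snoc.prems(1) by (auto simp: awalk_Cons_iff awalk_Nil_iff)
  obtain q where q: "q \<in> SP G s t" "e \<in> set q" "\<phi> q > 0"
    using arc_flow_pos_path[OF f snoc.prems(2)[of e]] by auto
  then obtain q1 q2 where q12: "q = q1 @ e # q2" by (auto simp: in_set_conv_decomp)
  have w: "awalk s q t" using SP_D(1)[OF q(1)] by (simp add: st_paths_def)
  then have "awalk s q1 (tail G e)" "awalk v q2 t" using e(2) unfolding q12 by (auto simp: awalk_Cons_iff)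
  then have 1: "path_latency G s t l \<phi> p \<le> path_latency G s t l \<phi> q1"
    using snoc.IH[OF e(1)] snoc.prems(2) by auto
  have "awalk s (x @ q2) t" using snoc.prems(3) \<open>awalk v q2 t\<close> by (rule awalk_appendI)
  then have "path_latency G s t l \<phi> q \<le> path_latency G s t l \<phi> (x @ q2)"
    using \<phi> q(3) w unfolding wardrop_flow_def st_paths_def by blast
  moreover have "q = (q1 @ [e]) @ q2" using q12 by simp
  ultimately have "path_latency G s t l \<phi> (q1 @ [e]) \<le> path_latency G s t l \<phi> x"
    by (simp only: path_latency_append)
  with 1 show ?case by (simp add: path_latency_append)
qed

section \<open>Comparison with a subgraph\<close>

lemma subgraph_st_net:
  assumes "subgraph H G" "st_paths H s t \<noteq> {}"
  shows "st_net H s t"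
proof -
  interpret H: fin_digraph H using assms(1) by (rule fin_digraph_subgraph)
  obtain p where "H.awalk s p t" using assms(2) by (auto simp: st_paths_def)
  then have "s \<in> verts H" "t \<in> verts H" by auto
  then show ?thesis by unfold_locales
qed

lemma subgraph_SP: "subgraph H G \<Longrightarrow> SP H s t \<subseteq> SP G s t"
  using subgraph_apath_imp_apath by (auto simp: SP_def)

lemma SP_nonempty:
  assumes "st_paths G s t \<noteq> {}" shows "SP G s t \<noteq> {}"
  using assms apath_awalk_to_apath by (auto simp: SP_def st_paths_def)

text \<open>A path \<open>p\<close> of arcs with \<open>0 < y e\<close> and
  \<open>x e \<le> y e\<close> bounds the latency of \<open>G\<close> from above: by monotonicity
  its latency under \<phi> is at most that under \<psi>, and there it is a shortest path.\<close>

lemma wardrop_latency_subgraph_le: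
  assumes no: "\<nexists>\<phi> \<psi>. st_embedding G s t \<phi> \<psi>"
    and l: "latency_fun G l" and r: "r \<ge> 0" and H: "subgraph H G" "st_paths H s t \<noteq> {}"
  shows "wardrop_latency G s t r l \<le> wardrop_latency H s t r l"
proof (cases "r = 0")
  case False
  with r have r: "r > 0" by simp
  interpret H: st_net H s t using H by (rule subgraph_st_net)
  have arcsH: "arcs H \<subseteq> arcs G" and comp: "compatible G H" using H(1) by auto
  have lH: "latency_fun H l" using l arcsH by (auto simp: latency_fun_def)
  have SPH: "SP H s t \<subseteq> SP G s t" using H(1) by (rule subgraph_SP)
  have neH: "SP H s t \<noteq> {}" using H(2) by (rule H.SP_nonempty)
  then have neG: "SP G s t \<noteq> {}" using SPH by auto
  obtain \<phi> where \<phi>: "wardrop_flow G s t r l \<phi>" using wardrop_flow_exists[OF l less_imp_le[OF r] neG] by blast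
  obtain \<psi> where \<psi>: "wardrop_flow H s t r l \<psi>" using H.wardrop_flow_exists[OF lH less_imp_le[OF r] neH] by blast
  have f: "is_flow G s t \<phi>" "flow_value G s t \<phi> = r" using \<phi> by (auto simp: wardrop_flow_def)
  have g: "is_flow H s t \<psi>" "flow_value H s t \<psi> = r" using \<psi> by (auto simp: wardrop_flow_def)
  obtain p0 where p0: "p0 \<in> SP G s t" "\<phi> p0 > 0" using positive_flow_path[of \<phi>] f(2) r by auto
  obtain q0 where q0: "q0 \<in> SP H s t" "\<psi> q0 > 0" using H.positive_flow_path[of \<psi>] g(2) r by auto
  define x where "x = arc_flow G s t \<phi>" define y where "y = arc_flow H s t \<psi>"
  have xy: "0 \<le> x e" "0 \<le> y e" for e
    using arc_flow_nonneg[OF f(1)] H.arc_flow_nonneg[OF g(1)] by (auto simp: x_def y_def)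
  \<comment> \<open>The arcs unfit for such a path; if they meet every \<open>st\<close>-path, they
    contain a cut crossed exactly once by every simple path.\<close>
  define B where "B = {e \<in> arcs G. y e = 0 \<or> y e < x e}"
  have "\<exists>p. awalk s p t \<and> set p \<inter> B = {}"
  proof (rule ccontr)
    assume "\<not> ?thesis"
    then have cut: "set p \<inter> B \<noteq> {}" if "awalk s p t" for p using that by blast
    have "finite B" by (simp add: B_def)
    obtain C where C: "C \<subseteq> B" "\<And>p. apath s p t \<Longrightarrow> card (set p \<inter> C) = 1"
      by (rule min_cut_crossed_once_or_embedding[OF \<open>finite B\<close> cut no], simp, rule that)
    have finC: "finite C" using C(1) \<open>finite B\<close> by (rule finite_subset)
    have "card (C \<inter> set p) = 1" if "p \<in> SP G s t" for p using C(2) that by (simp add: SP_def Int_commute)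
    note once = this
    \<comment> \<open>Each simple path contributes once, so both flows cross \<open>C\<close> with
      their full value \<open>r\<close>.\<close>
    have "sum x C = (\<Sum>p\<in>SP G s t. \<phi> p * real (card (C \<inter> set p)))"
      using sum_arc_flow_mult[OF finC, of \<phi> "\<lambda>_. 1"] by (simp add: x_def)
    also have "\<dots> = r" using once f(2) by (simp add: flow_value_def)
    finally have sx: "sum x C = r" .
    have "sum y C = (\<Sum>p\<in>SP H s t. \<psi> p * real (card (C \<inter> set p)))"
      using H.sum_arc_flow_mult[OF finC, of \<psi> "\<lambda>_. 1"] by (simp add: y_def)
    also have "\<dots> = (\<Sum>p\<in>SP H s t. \<psi> p)"
      by (intro sum.cong refl) (simp add: once subsetD[OF SPH])
    finally have sy: "sum y C = r" using g(2) by (simp add: flow_value_def)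
    \<comment> \<open>On \<open>B\<close> either \<open>y e\<close> is zero or
      \<open>y e < x e\<close>. Equal sums force \<open>x e = y e\<close> on \<open>C\<close>, which
      leaves only \<open>y e = 0\<close> and contradicts the positive value
      \<open>r\<close>.\<close>
    have le: "y e \<le> x e" if "e \<in> C" for e using that C(1) xy[of e] by (auto simp: B_def)
    have "(\<Sum>e\<in>C. x e - y e) = 0" using sx sy by (simp add: sum_subtractf)
    then have "\<forall>e\<in>C. x e - y e = 0" using le finC by (subst (asm) sum_nonneg_eq_0_iff) auto
    then have "\<forall>e\<in>C. y e = 0" using C(1) by (auto simp: B_def)
    then have "sum y C = 0" by simp
    with sy r show False by simp
  qed
  then obtain p where p: "awalk s p t" "set p \<inter> B = {}" by blast
  have pG: "set p \<subseteq> arcs G" using p(1) by blast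
  have good: "0 < y e" "x e \<le> y e" if "e \<in> set p" for e
  proof -
    have "e \<in> arcs G" "e \<notin> B" using that p(2) pG by auto
    then show "0 < y e" "x e \<le> y e" using xy(2)[of e] by (auto simp: B_def)
  qed
  \<comment> \<open>Arcs carrying flow of \<psi> belong to \<open>H\<close>, so \<open>p\<close> is
    a walk of \<open>H\<close> as well.\<close>
  have pH: "set p \<subseteq> arcs H"
  proof
    fix e assume "e \<in> set p"
    then obtain q where "q \<in> SP H s t" "e \<in> set q"
      using H.arc_flow_pos_path[OF g(1)] good(1) unfolding y_def by metis
    then show "e \<in> arcs H" using H.SP_D(2) by auto
  qed
  then have "H.awalk s p t"
    using p(1) comp H.source_in_verts by (auto simp: awalk_def H.awalk_def compatible_cas)
  moreover have q0': "H.awalk s q0 t" using H.SP_D(1)[OF q0(1)] by (simp add: st_paths_def)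
  ultimately have "path_latency H s t l \<psi> p \<le> path_latency H s t l \<psi> q0"
    using H.positive_flow_walk_shortest[OF lH \<psi>] good(1) by (simp add: y_def)
  moreover have "path_latency G s t l \<phi> p \<le> path_latency H s t l \<psi> p"
    unfolding path_latency_def x_def[symmetric] y_def[symmetric]
    by (intro sum_list_mono latency_fun_mono[OF l]) (use pG xy good in auto)
  moreover have "path_latency G s t l \<phi> p0 \<le> path_latency G s t l \<phi> p"
    using \<phi> p0 SP_D(1)[OF p0(1)] p(1) unfolding wardrop_flow_def st_paths_def by blast
  ultimately show ?thesis
    using wardrop_latency_eq[OF l r \<phi> p0(2)] H.wardrop_latency_eq[OF lH r \<psi> q0(2)] by simp
qed (simp add: wardrop_latency_def)

end

section \<open>Nets with an embedding are vulnerable\<close>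

lemma sum_list_map_zero: "(\<And>x. x \<in> set xs \<Longrightarrow> f x = 0) \<Longrightarrow> sum_list (map f xs) = (0 :: real)"
  by (induction xs) auto

context wf_digraph
begin

text \<open>The bounds telescope along the walk. A potential thus certifies a lower bound for the
  length of every walk at once.\<close>

lemma potential_le_sum_list:
  fixes w :: "'b \<Rightarrow> real"
  assumes "awalk u p v" "\<And>e. e \<in> set p \<Longrightarrow> \<pi> (head G e) \<le> \<pi> (tail G e) + w e"
  shows "\<pi> v \<le> \<pi> u + sum_list (map w p)"
  using assms
proof (induction p arbitrary: u)
  case (Cons e p)
  then have "\<pi> v \<le> \<pi> (head G e) + sum_list (map w p)" "\<pi> (head G e) \<le> \<pi> u + w e"
    by (auto simp: awalk_Cons_iff)
  then show ?case by simp
qed (simp add: awalk_Nil_iff)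

lemma apath_appendI_verts:
  assumes "apath u p w" "apath w q v" "set (awalk_verts u p) \<inter> set (awalk_verts w q) \<subseteq> {w}"
  shows "apath u (p @ q) v \<and> set (awalk_verts u (p @ q)) = set (awalk_verts u p) \<union> set (awalk_verts w q)"
  using apath_appendI[OF assms] set_awalk_verts_append[of u p w q v] assms by (auto simp: apath_def)

lemma apath_Cons_tail:
  assumes "apath u (e # p) v" "f \<in> set p"
  shows "tail G f \<noteq> u"
proof -
  have "tail G f \<in> set (awalk_verts (head G e) p)" using assms(2) by (rule awalk_verts_arc1)
  then show ?thesis using assms(1) by (auto simp: apath_Cons_iff)
qed

end

text \<open>An \<open>st_embedding\<close> with its four nodes, its five paths and the links
  \<open>p\<close> from \<open>s\<close> and \<open>q\<close> to \<open>t\<close> as separate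
  parameters.\<close>

locale wheatstone_net = st_net +
  fixes a b c d p ab ac bc bd cd q
  assumes paths: "apath s p a" "apath a ab b" "apath a ac c" "apath b bc c" "apath b bd d" "apath c cd d" "apath d q t"
    and distinct_nodes: "distinct [a, b, c, d]"
    and node_disjoint:
      "set (awalk_verts a ab) \<inter> set (awalk_verts a ac) \<subseteq> {a}"
      "set (awalk_verts a ab) \<inter> set (awalk_verts b bc) \<subseteq> {b}"
      "set (awalk_verts a ab) \<inter> set (awalk_verts b bd) \<subseteq> {b}"
      "set (awalk_verts a ab) \<inter> set (awalk_verts c cd) \<subseteq> {}"
      "set (awalk_verts a ac) \<inter> set (awalk_verts b bc) \<subseteq> {c}"
      "set (awalk_verts a ac) \<inter> set (awalk_verts b bd) \<subseteq> {}"
      "set (awalk_verts a ac) \<inter> set (awalk_verts c cd) \<subseteq> {c}"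
      "set (awalk_verts b bc) \<inter> set (awalk_verts b bd) \<subseteq> {b}"
      "set (awalk_verts b bc) \<inter> set (awalk_verts c cd) \<subseteq> {c}"
      "set (awalk_verts b bd) \<inter> set (awalk_verts c cd) \<subseteq> {d}"
      "set (awalk_verts s p) \<inter> set (awalk_verts d q) = {}"
      "set (awalk_verts s p) \<inter> (set (awalk_verts a ab) \<union> set (awalk_verts a ac) \<union> set (awalk_verts b bc)
         \<union> set (awalk_verts b bd) \<union> set (awalk_verts c cd)) = {a}"
      "set (awalk_verts d q) \<inter> (set (awalk_verts a ab) \<union> set (awalk_verts a ac) \<union> set (awalk_verts b bc)
         \<union> set (awalk_verts b bd) \<union> set (awalk_verts c cd)) = {d}"
begin

section \<open>Disjointness of the seven pieces\<close>

abbreviation "Vp \<equiv> set (awalk_verts s p)"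
abbreviation "Vq \<equiv> set (awalk_verts d q)"
abbreviation "Vab \<equiv> set (awalk_verts a ab)"
abbreviation "Vac \<equiv> set (awalk_verts a ac)"
abbreviation "Vbc \<equiv> set (awalk_verts b bc)"
abbreviation "Vbd \<equiv> set (awalk_verts b bd)"
abbreviation "Vcd \<equiv> set (awalk_verts c cd)"

lemma nodes_neq: "a \<noteq> b" "a \<noteq> c" "a \<noteq> d" "b \<noteq> c" "b \<noteq> d" "c \<noteq> d"
  using distinct_nodes by auto

lemma ends_in_verts: "a \<in> Vp" "a \<in> Vab" "a \<in> Vac" "b \<in> Vab" "b \<in> Vbc" "b \<in> Vbd" "c \<in> Vac" "c \<in> Vbc" "c \<in> Vcd"
  "d \<in> Vbd" "d \<in> Vcd" "d \<in> Vq"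
  using paths by (auto simp: apath_def hd_in_awalk_verts last_in_awalk_verts)

text \<open>The hypotheses only say where \<open>p\<close> and \<open>q\<close> meet the union of
  the five paths. As \<open>a\<close> is off \<open>bc\<close>, \<open>bd\<close>, \<open>cd\<close>
  and \<open>d\<close> is off \<open>ab\<close>, \<open>ac\<close>, \<open>bc\<close>, the path
  \<open>p\<close> misses the former three and \<open>q\<close> the latter three.\<close>

lemma verts_meet:
  "Vp \<inter> Vab \<subseteq> {a}" "Vp \<inter> Vac \<subseteq> {a}" "Vp \<inter> Vbc \<subseteq> {}" "Vp \<inter> Vbd \<subseteq> {}" "Vp \<inter> Vcd \<subseteq> {}" "Vp \<inter> Vq \<subseteq> {}"
  "Vab \<inter> Vq \<subseteq> {}" "Vac \<inter> Vq \<subseteq> {}" "Vbc \<inter> Vq \<subseteq> {}" "Vbd \<inter> Vq \<subseteq> {d}" "Vcd \<inter> Vq \<subseteq> {d}"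
proof -
  have P: "Vp \<inter> Vab \<subseteq> {a}" "Vp \<inter> Vac \<subseteq> {a}" "Vp \<inter> Vbc \<subseteq> {a}" "Vp \<inter> Vbd \<subseteq> {a}" "Vp \<inter> Vcd \<subseteq> {a}"
    using node_disjoint(12) by blast+
  have Q: "Vab \<inter> Vq \<subseteq> {d}" "Vac \<inter> Vq \<subseteq> {d}" "Vbc \<inter> Vq \<subseteq> {d}" "Vbd \<inter> Vq \<subseteq> {d}" "Vcd \<inter> Vq \<subseteq> {d}"
    using node_disjoint(13) by blast+
  have a: "a \<notin> Vbc" "a \<notin> Vbd" "a \<notin> Vcd" using node_disjoint(2,3,4) ends_in_verts(2) nodes_neq(1) by auto
  have d: "d \<notin> Vab" "d \<notin> Vac" "d \<notin> Vbc" using node_disjoint(4,7,9) ends_in_verts(11) nodes_neq(6) by auto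
  show "Vp \<inter> Vab \<subseteq> {a}" "Vp \<inter> Vac \<subseteq> {a}" using P by auto
  show "Vp \<inter> Vbc \<subseteq> {}" "Vp \<inter> Vbd \<subseteq> {}" "Vp \<inter> Vcd \<subseteq> {}" using P(3-5) a by auto
  show "Vab \<inter> Vq \<subseteq> {}" "Vac \<inter> Vq \<subseteq> {}" "Vbc \<inter> Vq \<subseteq> {}" using Q(1-3) d by auto
  show "Vbd \<inter> Vq \<subseteq> {d}" "Vcd \<inter> Vq \<subseteq> {d}" using Q(4,5) by auto
  show "Vp \<inter> Vq \<subseteq> {}" using node_disjoint(11) by simp
qed

text \<open>No arc lies on two pieces, so latencies can be prescribed piece by piece.\<close>

lemma distinct_arcs: "distinct (p @ ab @ ac @ bc @ bd @ cd @ q)"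
proof -
  note D = apath_imp_distinct
  have J: "set x \<inter> set y = {}"
    if "apath u x v" "apath u' y v'" "set (awalk_verts u x) \<inter> set (awalk_verts u' y) \<subseteq> Z" "Z \<subseteq> {w}"
    for u x v u' y v' Z w
    using arcs_disjoint_if_verts_meet_once[of u x v u' y v' w] that by (auto simp: apath_def)
  note J' = J[OF _ _ _ subset_refl] J[OF _ _ _ empty_subsetI]
  note disj =
    J'(1)[OF paths(1) paths(2) verts_meet(1)] J'(1)[OF paths(1) paths(3) verts_meet(2)] J'(2)[OF paths(1) paths(4) verts_meet(3)]
    J'(2)[OF paths(1) paths(5) verts_meet(4)] J'(2)[OF paths(1) paths(6) verts_meet(5)] J'(2)[OF paths(1) paths(7) verts_meet(6)]
    J'(1)[OF paths(2) paths(3) node_disjoint(1)] J'(1)[OF paths(2) paths(4) node_disjoint(2)] J'(1)[OF paths(2) paths(5) node_disjoint(3)]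
    J'(2)[OF paths(2) paths(6) node_disjoint(4)] J'(1)[OF paths(3) paths(4) node_disjoint(5)] J'(2)[OF paths(3) paths(5) node_disjoint(6)]
    J'(1)[OF paths(3) paths(6) node_disjoint(7)] J'(1)[OF paths(4) paths(5) node_disjoint(8)] J'(1)[OF paths(4) paths(6) node_disjoint(9)]
    J'(1)[OF paths(5) paths(6) node_disjoint(10)] J'(2)[OF paths(2) paths(7) verts_meet(7)] J'(2)[OF paths(3) paths(7) verts_meet(8)]
    J'(2)[OF paths(4) paths(7) verts_meet(9)] J'(1)[OF paths(5) paths(7) verts_meet(10)] J'(1)[OF paths(6) paths(7) verts_meet(11)]
  show ?thesis
    using paths[THEN D] unfolding distinct_append set_append by (simp add: disj Int_Un_distrib)
qed

lemma st_paths_through: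
  "apath s (p @ ab @ bc @ cd @ q) t" "apath s (p @ ab @ bd @ q) t" "apath s (p @ ac @ cd @ q) t"
proof -
  have cdq: "apath c (cd @ q) t \<and> set (awalk_verts c (cd @ q)) = Vcd \<union> Vq"
    using verts_meet by (intro apath_appendI_verts paths)
  have bdq: "apath b (bd @ q) t \<and> set (awalk_verts b (bd @ q)) = Vbd \<union> Vq"
    using verts_meet by (intro apath_appendI_verts paths)
  have bcdq: "apath b (bc @ cd @ q) t \<and> set (awalk_verts b (bc @ cd @ q)) = Vbc \<union> (Vcd \<union> Vq)"
    using apath_appendI_verts[OF paths(4) conjunct1[OF cdq]] cdq verts_meet(9) node_disjoint(9) by blast
  have abcdq: "apath a (ab @ bc @ cd @ q) t \<and> set (awalk_verts a (ab @ bc @ cd @ q)) = Vab \<union> (Vbc \<union> (Vcd \<union> Vq))"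
    using apath_appendI_verts[OF paths(2) conjunct1[OF bcdq]] bcdq verts_meet(7) node_disjoint(2,4) by blast
  have abdq: "apath a (ab @ bd @ q) t \<and> set (awalk_verts a (ab @ bd @ q)) = Vab \<union> (Vbd \<union> Vq)"
    using apath_appendI_verts[OF paths(2) conjunct1[OF bdq]] bdq verts_meet(7) node_disjoint(3) by blast
  have acdq: "apath a (ac @ cd @ q) t \<and> set (awalk_verts a (ac @ cd @ q)) = Vac \<union> (Vcd \<union> Vq)"
    using apath_appendI_verts[OF paths(3) conjunct1[OF cdq]] cdq verts_meet(8) node_disjoint(7) by blast
  show "apath s (p @ ab @ bc @ cd @ q) t"
    using apath_appendI[OF paths(1) conjunct1[OF abcdq]] abcdq verts_meet by blast
  show "apath s (p @ ab @ bd @ q) t"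
    using apath_appendI[OF paths(1) conjunct1[OF abdq]] abdq verts_meet by blast
  show "apath s (p @ ac @ cd @ q) t"
    using apath_appendI[OF paths(1) conjunct1[OF acdq]] acdq verts_meet by blast
qed

lemma nonempty: "ab \<noteq> []" "ac \<noteq> []" "bd \<noteq> []" "cd \<noteq> []"
  using paths(2,3,5,6) nodes_neq by (auto simp: apath_Nil_iff)

text \<open>The potential is \<open>0\<close> on \<open>p\<close>, \<alpha> on the rest of
  \<open>ab\<close>, \<open>1\<close> on the rest of \<open>ac\<close> and \<open>bc\<close>, and
  \<gamma> elsewhere. Apart from \<open>bc\<close>, it rises only at the first arcs of
  \<open>ab\<close>, \<open>ac\<close>, \<open>bd\<close>, \<open>cd\<close> and on arcs outside the
  pieces; on \<open>bc\<close> it may rise from \<alpha> to \<open>1\<close>, hence the alternative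
  for \<open>x\<close>.\<close>

lemma potential_bound:
  fixes w :: "'b \<Rightarrow> real" and \<alpha> \<gamma> :: real
  assumes \<alpha>: "0 \<le> \<alpha>" "\<alpha> \<le> 1" and \<gamma>: "1 \<le> \<gamma>"
    and heads: "\<alpha> \<le> w (hd ab)" "1 \<le> w (hd ac)" "\<gamma> - \<alpha> \<le> w (hd bd)" "\<gamma> - 1 \<le> w (hd cd)"
    and nonneg: "\<And>e. 0 \<le> w e"
    and outside: "\<And>e. e \<notin> set (p @ ab @ ac @ bc @ bd @ cd @ q) \<Longrightarrow> \<gamma> \<le> w e"
    and x: "awalk s x t" and bc: "\<alpha> = 1 \<or> set x \<inter> set bc = {}"
  shows "\<gamma> \<le> sum_list (map w x)"
proof -
  define \<pi> where "\<pi> v = (if v \<in> Vp then 0 else if v \<in> Vab then \<alpha> else if v \<in> Vac \<union> Vbc then 1 else \<gamma>)" for v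
  have \<pi>0: "\<pi> v = 0" if "v \<in> Vp" for v using that by (simp add: \<pi>_def)
  have \<pi>_range: "0 \<le> \<pi> v" "\<pi> v \<le> \<gamma>" for v using \<alpha> \<gamma> by (auto simp: \<pi>_def)
  have \<pi>ab: "\<pi> v \<le> \<alpha>" if "v \<in> Vab" for v using that \<alpha> by (simp add: \<pi>_def)
  have \<pi>abc: "\<pi> v \<le> 1" if "v \<in> Vac \<or> v \<in> Vbc" for v using that \<alpha> by (simp add: \<pi>_def)
  have \<pi>ab': "\<pi> v = \<alpha>" if "v \<in> Vab" "v \<noteq> a" for v using that verts_meet(1) by (auto simp: \<pi>_def)
  have \<pi>ac': "\<pi> v = 1" if "v \<in> Vac" "v \<noteq> a" for v
    using that verts_meet(2) node_disjoint(1) by (auto simp: \<pi>_def)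
  have \<pi>bc': "\<alpha> \<le> \<pi> v" if "v \<in> Vbc" for v using that verts_meet(3) \<alpha> by (auto simp: \<pi>_def)
  have \<pi>bd': "\<pi> v = \<gamma>" if "v \<in> Vbd" "v \<noteq> b" for v
    using that verts_meet(4) node_disjoint(3,6,8) by (auto simp: \<pi>_def)
  have \<pi>cd': "\<pi> v = \<gamma>" if "v \<in> Vcd" "v \<noteq> c" for v
    using that verts_meet(5) node_disjoint(4,7,9) by (auto simp: \<pi>_def)
  have \<pi>q': "\<pi> v = \<gamma>" if "v \<in> Vq" for v
    using that verts_meet(6-9) by (auto simp: \<pi>_def)
  have ends: "tail G e \<in> set (awalk_verts u y) \<and> head G e \<in> set (awalk_verts u y)"
    if "apath u y v" "e \<in> set y" for e u y v
    using that awalk_verts_arc1 awalk_verts_arc2 by (auto simp: apath_def)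
  \<comment> \<open>On a simple path only the first arc leaves the start node; every other arc has
    its tail after that node, where the potential of the piece is already reached.\<close>
  have hd_or_tail: "tail G e = u \<and> e = hd y \<or> tail G e \<noteq> u" 
    if y: "apath u y v" "e \<in> set y" for e u y v
  proof (cases y)
    case (Cons f z)
    with y apath_Cons_tail[of u f z v e] show ?thesis by (auto simp: apath_Cons_iff)
  qed (use y in simp)
  have step: "\<pi> (head G e) \<le> \<pi> (tail G e) + w e" if e: "e \<in> set x" for e
  proof -
    consider "e \<in> set p" | "e \<in> set ab" | "e \<in> set ac" | "e \<in> set bc" | "e \<in> set bd" | "e \<in> set cd" | "e \<in> set q"
      | "e \<notin> set (p @ ab @ ac @ bc @ bd @ cd @ q)" by auto
    then show ?thesis
    proof cases
      case 1
      then have "\<pi> (head G e) = 0" using \<pi>0 ends[OF paths(1)] by simp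
      then show ?thesis using \<pi>_range(1)[of "tail G e"] nonneg[of e] by linarith
    next
      case 2
      then have "\<pi> (head G e) \<le> \<alpha>" "tail G e \<in> Vab" using \<pi>ab ends[OF paths(2)] by auto
      then show ?thesis
        using hd_or_tail[OF paths(2) 2] \<pi>ab' \<pi>_range(1)[of "tail G e"] nonneg[of e] heads(1) by fastforce
    next
      case 3
      then have "\<pi> (head G e) \<le> 1" "tail G e \<in> Vac" using \<pi>abc ends[OF paths(3)] by auto
      then show ?thesis
        using hd_or_tail[OF paths(3) 3] \<pi>ac' \<pi>_range(1)[of "tail G e"] nonneg[of e] heads(2) by fastforce
    next
      case 4
      then have "\<alpha> = 1" using bc e by auto
      moreover have "\<pi> (head G e) \<le> 1" "\<alpha> \<le> \<pi> (tail G e)" using \<pi>abc \<pi>bc' ends[OF paths(4) 4] by auto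
      ultimately show ?thesis using nonneg[of e] by linarith
    next
      case 5
      have "\<pi> b = \<alpha>" using \<pi>ab' ends_in_verts(4) nodes_neq(1) by auto
      moreover have "tail G e \<in> Vbd" using ends[OF paths(5) 5] by simp
      ultimately show ?thesis
        using hd_or_tail[OF paths(5) 5] \<pi>bd' \<pi>_range(2)[of "head G e"] nonneg[of e] heads(3) by fastforce
    next
      case 6
      have "\<pi> c = 1" using \<pi>ac' ends_in_verts(7) nodes_neq(2) by auto
      moreover have "tail G e \<in> Vcd" using ends[OF paths(6) 6] by simp
      ultimately show ?thesis
        using hd_or_tail[OF paths(6) 6] \<pi>cd' \<pi>_range(2)[of "head G e"] nonneg[of e] heads(4) by fastforce
    next
      case 7
      then have "\<pi> (tail G e) = \<gamma>" using \<pi>q' ends[OF paths(7)] by simp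
      then show ?thesis using \<pi>_range(2)[of "head G e"] nonneg[of e] by linarith
    next
      case 8
      then show ?thesis using outside \<pi>_range(1)[of "tail G e"] \<pi>_range(2)[of "head G e"] by fastforce
    qed
  qed
  have "\<pi> t \<le> \<pi> s + sum_list (map w x)" using x step by (rule potential_le_sum_list)
  moreover have "\<pi> s = 0" using \<pi>0 paths(1) hd_in_awalk_verts by simp
  moreover have "\<pi> t = \<gamma>" using \<pi>q' paths(7) last_in_awalk_verts by (simp add: apath_def)
  ultimately show ?thesis by simp
qed

text \<open>
  Braess's example with total flow \<open>1\<close>. In the whole net all flow takes \<open>ab\<close>, \<open>bc\<close>, \<open>cd\<close>, with
  latency \<open>2\<close>; without \<open>bc\<close> it splits evenly over the two remaining paths, with latency \<open>3/2\<close>.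
\<close>

definition braess_latency :: "'b \<Rightarrow> real \<Rightarrow> real" where
  "braess_latency e x = (if e = hd ab \<or> e = hd cd then x else if e = hd ac \<or> e = hd bd then 1
     else if e \<in> set (p @ ab @ ac @ bc @ bd @ cd @ q) then 0 else 2)"

lemma latency_fun_braess: "latency_fun H braess_latency"
  unfolding latency_fun_def
proof (intro ballI conjI allI impI)
  fix e
  show "continuous_on {0..} (braess_latency e)"
    unfolding braess_latency_def by (cases "e = hd ab \<or> e = hd cd") (auto intro!: continuous_intros)
  show "mono_on {0..} (braess_latency e)" by (auto simp: mono_on_def braess_latency_def)
qed (simp add: braess_latency_def)

lemma braess_vulnerable: "vulnerable G s t"
proof -
  obtain e1 ab' where ab: "ab = e1 # ab'" using nonempty by (cases ab) auto
  obtain e2 ac' where ac: "ac = e2 # ac'" using nonempty by (cases ac) auto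
  obtain e3 bd' where bd: "bd = e3 # bd'" using nonempty by (cases bd) auto
  obtain e4 cd' where cd: "cd = e4 # cd'" using nonempty by (cases cd) auto
  note dist = distinct_arcs[unfolded ab ac bd cd]
  define P0 where "P0 = p @ ab @ bc @ cd @ q"
  define P1 where "P1 = p @ ab @ bd @ q"
  define P2 where "P2 = p @ ac @ cd @ q"
  let ?l = braess_latency
  have heads: "hd ab = e1" "hd ac = e2" "hd bd = e3" "hd cd = e4" by (simp_all add: ab ac bd cd)
  have de: "e1 \<noteq> e2" "e1 \<noteq> e3" "e1 \<noteq> e4" "e2 \<noteq> e3" "e2 \<noteq> e4" "e3 \<noteq> e4" using dist by auto
  have l: "?l e1 x = x" "?l e4 x = x" "?l e2 x = 1" "?l e3 x = 1" for x
    using de by (simp_all add: braess_latency_def heads)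
  have l0: "?l e x = 0" if e: "e \<in> set (p @ ab' @ ac' @ bc @ bd' @ cd' @ q)" for e x
  proof -
    have "e \<noteq> e1" "e \<noteq> e2" "e \<noteq> e3" "e \<noteq> e4" using e dist by auto
    moreover have "e \<in> set (p @ ab @ ac @ bc @ bd @ cd @ q)" using e by (auto simp: ab ac bd cd)
    ultimately show ?thesis unfolding braess_latency_def heads by simp
  qed
  have l2: "?l e x = 2" if e: "e \<notin> set (p @ ab @ ac @ bc @ bd @ cd @ q)" for e x
  proof -
    have "e \<noteq> e1" "e \<noteq> e2" "e \<noteq> e3" "e \<noteq> e4" using e by (auto simp: ab ac bd cd)
    with e show ?thesis unfolding braess_latency_def heads by simp
  qed
  have lnn: "0 \<le> ?l e x" if "0 \<le> x" for e x using that by (simp add: braess_latency_def)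
  have z: "sum_list (map (\<lambda>e. ?l e (g e)) p) = 0" "sum_list (map (\<lambda>e. ?l e (g e)) ab') = 0" "sum_list (map (\<lambda>e. ?l e (g e)) ac') = 0"
    "sum_list (map (\<lambda>e. ?l e (g e)) bc) = 0" "sum_list (map (\<lambda>e. ?l e (g e)) bd') = 0" "sum_list (map (\<lambda>e. ?l e (g e)) cd') = 0" "sum_list (map (\<lambda>e. ?l e (g e)) q) = 0" for g
    by (intro sum_list_map_zero l0; simp)+

  have split: "sum_list (map f ab) = f e1 + sum_list (map f ab')" "sum_list (map f ac) = f e2 + sum_list (map f ac')"
    "sum_list (map f bd) = f e3 + sum_list (map f bd')" "sum_list (map f cd) = f e4 + sum_list (map f cd')"
    for f :: "'b \<Rightarrow> real"
    by (simp_all add: ab ac bd cd)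

  \<comment> \<open>The Wardrop flow of the whole net\<close>
  define \<phi> where "\<phi> x = (if x = P0 then 1 else 0 :: real)" for x
  have P0: "P0 \<in> SP G s t" using st_paths_through by (simp add: SP_def P0_def)
  have \<phi>: "is_flow G s t \<phi>" "flow_value G s t \<phi> = 1"
    using P0 by (auto simp: is_flow_def flow_value_def \<phi>_def)
  have af: "arc_flow G s t \<phi> e = indicator (set P0) e" for e
    using P0 by (simp add: arc_flow_conv \<phi>_def if_distrib[of "\<lambda>y. y * _"] cong: if_cong)
  have on_P0: "e1 \<in> set P0" "e4 \<in> set P0" by (simp_all add: P0_def ab cd)
  have "path_latency G s t ?l \<phi> P0 = ?l e1 (arc_flow G s t \<phi> e1) + ?l e4 (arc_flow G s t \<phi> e4)"
    unfolding path_latency_def by (subst P0_def) (simp add: split z)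
  then have lat0: "path_latency G s t ?l \<phi> P0 = 2" by (simp add: l af on_P0)
  \<comment> \<open>Here \<alpha> = 1 and \<gamma> = 2: at this flow the first arcs of
    \<open>ab\<close>, \<open>ac\<close>, \<open>bd\<close>, \<open>cd\<close> all have latency
    \<open>1\<close>, so their bounds are tight.\<close>
  have "2 \<le> path_latency G s t ?l \<phi> x" if x: "x \<in> st_paths G s t" for x
    unfolding path_latency_def
  proof (rule potential_bound[of 1])
    show "awalk s x t" using x by (simp add: st_paths_def)
  qed (simp_all add: heads l l2 lnn af on_P0)
  then have "wardrop_flow G s t 1 ?l \<phi>"
    using \<phi> lat0 by (auto simp: wardrop_flow_def \<phi>_def)
  then have L_G: "wardrop_latency G s t 1 ?l = 2"
    using wardrop_latency_eq[OF latency_fun_braess, of 1 \<phi> P0] lat0 by (simp add: \<phi>_def)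

  \<comment> \<open>The Wardrop flow after removing the arcs of \<open>bc\<close>\<close>
  define H where "H = G\<lparr>arcs := arcs G - set bc\<rparr>"
  have H_simps: "verts H = verts G" "arcs H = arcs G - set bc" "tail H = tail G" "head H = head G"
    by (auto simp: H_def)
  have "wf_digraph H" by unfold_locales (auto simp: H_simps)
  then have sub: "subgraph H G"
    unfolding subgraph_def compatible_def using wf_digraph_axioms by (simp add: H_simps)
  then have comp: "compatible G H" by auto
  have in_H: "x \<in> SP H s t" if "apath s x t" "set x \<inter> set bc = {}" for x
    using that comp unfolding SP_def pre_digraph.apath_def pre_digraph.awalk_def
    by (auto simp: compatible_cas compatible_awalk_verts H_simps)
  have P12: "P1 \<in> SP H s t" "P2 \<in> SP H s t"
  proof -
    have "set P1 \<inter> set bc = {}" "set P2 \<inter> set bc = {}"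
      using distinct_arcs by (auto simp: P1_def P2_def)
    then show "P1 \<in> SP H s t" "P2 \<in> SP H s t"
      using st_paths_through by (auto intro: in_H simp flip: P1_def P2_def)
  qed
  have on_P12: "e1 \<in> set P1" "e1 \<notin> set P2" "e4 \<notin> set P1" "e4 \<in> set P2"
    using dist by (auto simp: P1_def P2_def ab ac bd cd)
  then have ne12: "P1 \<noteq> P2" by auto
  have neH: "st_paths H s t \<noteq> {}"
    using P12 by (auto simp: SP_def st_paths_def pre_digraph.apath_def)
  interpret H: st_net H s t using sub neH by (rule subgraph_st_net)
  \<comment> \<open>Half a unit on each of \<open>P1\<close> and \<open>P2\<close>, so that
    \<open>e1\<close> and \<open>e4\<close> carry \<open>1/2\<close> each and both paths have
    latency \<open>3/2\<close>.\<close>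
  define \<psi> where "\<psi> x = ((if x = P1 then 1/2 else 0) + (if x = P2 then 1/2 else 0) :: real)" for x
  have \<psi>: "is_flow H s t \<psi>" "flow_value H s t \<psi> = 1"
    using P12 ne12 by (auto simp: is_flow_def flow_value_def \<psi>_def sum.distrib)
  have afH: "arc_flow H s t \<psi> e = (indicator (set P1) e + indicator (set P2) e) / 2" for e
  proof -
    have "\<psi> x * indicator (set x) e = (if x = P1 then indicator (set x) e / 2 else 0) + (if x = P2 then indicator (set x) e / 2 else 0)" for x
      by (simp add: \<psi>_def)
    then show ?thesis using P12 by (simp add: H.arc_flow_conv sum.distrib)
  qed
  have "path_latency H s t ?l \<psi> P1 = ?l e1 (arc_flow H s t \<psi> e1) + ?l e3 (arc_flow H s t \<psi> e3)"
    unfolding path_latency_def by (subst P1_def) (simp add: split z)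
  then have lat1: "path_latency H s t ?l \<psi> P1 = 3/2" by (simp add: l afH on_P12)
  have "path_latency H s t ?l \<psi> P2 = ?l e2 (arc_flow H s t \<psi> e2) + ?l e4 (arc_flow H s t \<psi> e4)"
    unfolding path_latency_def by (subst P2_def) (simp add: split z)
  then have lat2: "path_latency H s t ?l \<psi> P2 = 3/2" by (simp add: l afH on_P12)
  have used: "path_latency H s t ?l \<psi> x = 3/2" if "\<psi> x > 0" for x
    using that lat1 lat2 by (auto simp: \<psi>_def split: if_splits)
  \<comment> \<open>With \<alpha> = 1/2 and \<gamma> = 3/2 the bounds on the four first arcs are
    tight again; \<alpha> may be below \<open>1\<close> because walks of \<open>H\<close> avoid
    \<open>bc\<close>.\<close>
  have "3/2 \<le> path_latency H s t ?l \<psi> x" if x: "x \<in> st_paths H s t" for x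
    unfolding path_latency_def
  proof (rule potential_bound[of "1/2"])
    have "H.awalk s x t" using x by (simp add: st_paths_def)
    then show "awalk s x t" using sub by (rule subgraph_awalk_imp_awalk)
    have "set x \<subseteq> arcs H" using \<open>H.awalk s x t\<close> by blast
    then show "1/2 = (1::real) \<or> set x \<inter> set bc = {}" by (auto simp: H_simps)
  qed (simp_all add: heads l l2 lnn afH on_P12)
  then have "wardrop_flow H s t 1 ?l \<psi>"
    using \<psi> used unfolding wardrop_flow_def by metis
  then have L_H: "wardrop_latency H s t 1 ?l = 3/2"
    using H.wardrop_latency_eq[OF latency_fun_braess, of 1 \<psi> P1] lat1 by (simp add: \<psi>_def)
  show ?thesis
    unfolding vulnerable_def
    by (intro exI[of _ 1] exI[of _ ?l] exI[of _ H]) (simp add: L_G L_H latency_fun_braess sub neH)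
qed

end

lemma (in st_net) st_embedding_imp_vulnerable:
  assumes "st_embedding G s t \<phi> \<psi>"
  shows "vulnerable G s t"
proof -
  note E = assms[unfolded st_embedding_def wheatstone_def Let_def pre_digraph.simps]
  obtain p q where "wheatstone_net G s t (\<phi> Wa) (\<phi> Wb) (\<phi> Wc) (\<phi> Wd) p
    (\<psi> (Wa, Wb)) (\<psi> (Wa, Wc)) (\<psi> (Wb, Wc)) (\<psi> (Wb, Wd)) (\<psi> (Wc, Wd)) q"
  proof -
    obtain p q where pq: "apath s p (\<phi> Wa)" "apath (\<phi> Wd) q t"
      "set (awalk_verts s p) \<inter> set (awalk_verts (\<phi> Wd) q) = {}"
      "set (awalk_verts s p) \<inter> (\<Union>e\<in>{(Wa, Wb), (Wa, Wc), (Wb, Wc), (Wb, Wd), (Wc, Wd)}.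
         set (awalk_verts (\<phi> (fst e)) (\<psi> e))) = {\<phi> Wa}"
      "set (awalk_verts (\<phi> Wd) q) \<inter> (\<Union>e\<in>{(Wa, Wb), (Wa, Wc), (Wb, Wc), (Wb, Wd), (Wc, Wd)}.
         set (awalk_verts (\<phi> (fst e)) (\<psi> e))) = {\<phi> Wd}"
      using E by (elim conjE exE) (rule that)
    have apaths: "\<forall>e\<in>{(Wa, Wb), (Wa, Wc), (Wb, Wc), (Wb, Wd), (Wc, Wd)}. apath (\<phi> (fst e)) (\<psi> e) (\<phi> (snd e))"
      using E by (elim conjE) assumption
    have disjoint: "\<forall>e\<in>{(Wa, Wb), (Wa, Wc), (Wb, Wc), (Wb, Wd), (Wc, Wd)}.
      \<forall>f\<in>{(Wa, Wb), (Wa, Wc), (Wb, Wc), (Wb, Wd), (Wc, Wd)}. e \<noteq> f \<longrightarrow>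
        set (awalk_verts (\<phi> (fst e)) (\<psi> e)) \<inter> set (awalk_verts (\<phi> (fst f)) (\<psi> f))
          \<subseteq> \<phi> ` ({fst e, snd e} \<inter> {fst f, snd f})"
      using E by (elim conjE) assumption
    have "inj_on \<phi> {Wa, Wb, Wc, Wd}" using E by (elim conjE) assumption
    then have dist: "distinct [\<phi> Wa, \<phi> Wb, \<phi> Wc, \<phi> Wd]" by (auto simp: inj_on_def)
    have "wheatstone_net G s t (\<phi> Wa) (\<phi> Wb) (\<phi> Wc) (\<phi> Wd) p
      (\<psi> (Wa, Wb)) (\<psi> (Wa, Wc)) (\<psi> (Wb, Wc)) (\<psi> (Wb, Wd)) (\<psi> (Wc, Wd)) q"
      by unfold_locales (use pq dist apaths disjoint in \<open>simp_all add: Un_assoc\<close>)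
    then show thesis by (rule that)
  qed
  then show ?thesis by (rule wheatstone_net.braess_vulnerable)
qed

theorem theorem4p10:
  fixes G :: "('a, 'b) pre_digraph" and s t :: 'a
  assumes "st_net G s t"
    and "st_connected G s t"
  shows "vulnerable G s t \<longleftrightarrow> (\<exists>\<phi> \<psi>. st_embedding G s t \<phi> \<psi>)"
proof -
  interpret st_net G s t by fact
  show ?thesis
  proof
    assume "vulnerable G s t"
    then obtain r l H where "r \<ge> 0" "latency_fun G l" "subgraph H G" "st_paths H s t \<noteq> {}"
      "wardrop_latency G s t r l > wardrop_latency H s t r l"
      unfolding vulnerable_def by blast
    then show "\<exists>\<phi> \<psi>. st_embedding G s t \<phi> \<psi>"
      using wardrop_latency_subgraph_le[of l r H] by (meson not_le)
  next
    assume "\<exists>\<phi> \<psi>. st_embedding G s t \<phi> \<psi>"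
    then show "vulnerable G s t" using st_embedding_imp_vulnerable by blast
  qed
qed

end
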